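(* Let $n$ be a positive integer. The quadratic unitary Cayley graph $G_n$ admits fractional revival if and only if $n\in\{2,4,2p\}$ for some prime $p$ such that $p\equiv 3\pmod 4$.
   Context: The quadratic unitary Cayley graph $G_n$ is the simple undirected graph with vertex set $\mathbb{Z}_n$ in which two distinct vertices $a,b$ are adjacent if and only if $a-b\equiv u^2$ or $a-b\equiv -u^2 \pmod n$ for some integer $u$ with $1\le u\le n-1$ and $\gcd(u,n)=1$. For a finite simple undirected graph $\Gamma$ with adjacency matrix $A$, the transition matrix is $H(t)=\exp(-\mathbf{i}tA)$, $t\in\mathbb{R}$, where $\mathbf{i}=\sqrt{-1}$. For a vertex $a$, $\mathbf{e}_a$ is the standard basis column vector indexed by the vertices with entry $1$ at $a$ and $0$ elsewhere. $\Gamma$ admits fractional revival (FR) from a vertex $a$ to another vertex $b\ne a$ if there is a real number $t>0$ such that $H(t)\mathbf{e}_a=\alpha\mathbf{e}_a+\beta\mathbf{e}_b$ for some complex numbers $\alpha,\beta$ with $\beta\neq 0$ and $|\alpha|^2+|\beta|^2=1$. $\Gamma$ admits FR if it does so from some vertex $a$ to some other vertex $b$. *)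

theory Defs
  imports
    "Graph_Theory.Pair_Digraph"
    "Jordan_Normal_Form.Jordan_Normal_Form"
    "HOL-Number_Theory.Cong"
begin

section \<open>The quadratic unitary Cayley graph\<close>

text \<open>
  The vertex set is the set of canonical representatives 0, ..., n - 1 of the residue
  classes modulo n. An undirected graph is a symmetric loop-free digraph (locale
  \<^locale>\<open>pair_graph\<close>): an edge is a pair of opposite arcs.
\<close>

definition quadratic_unitary_Cayley_graph :: "nat \<Rightarrow> nat pair_pre_digraph" where
  "quadratic_unitary_Cayley_graph n =
    \<lparr> pverts = {0..<n},
      parcs = {(a, b). a < n \<and> b < n \<and> a \<noteq> b \<and>
        (\<exists>u::int. 1 \<le> u \<and> u \<le> int n - 1 \<and> gcd u (int n) = 1 \<and>
          ([int a - int b = u\<^sup>2] (mod int n) \<or> [int a - int b = - (u\<^sup>2)] (mod int n)))} \<rparr>"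

lemma pair_graph_quadratic_unitary_Cayley_graph:
  "pair_graph (quadratic_unitary_Cayley_graph n)"
proof -
  let ?G = "quadratic_unitary_Cayley_graph n"
  have sub: "parcs ?G \<subseteq> {0..<n} \<times> {0..<n}"
    by (auto simp: quadratic_unitary_Cayley_graph_def)
  have fin: "finite (parcs ?G)"
    by (rule finite_subset[OF sub]) simp
  have flip: "[int b - int a = - c] (mod int n)" if "[int a - int b = c] (mod int n)" for a b c
    using that cong_minus_minus_iff[of "int a - int b" c "int n"] by simp
  have flip': "[int b - int a = c] (mod int n)" if "[int a - int b = - c] (mod int n)" for a b c
    using flip[OF that] by simp
  have sym: "symmetric ?G"
    unfolding symmetric_def
  proof (rule symI)
    fix a b
    assume "(a, b) \<in> arcs_ends ?G"
    then have ab: "a < n" "b < n" "a \<noteq> b" and "\<exists>u::int. 1 \<le> u \<and> u \<le> int n - 1 \<and> gcd u (int n) = 1 \<and>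
        ([int a - int b = u\<^sup>2] (mod int n) \<or> [int a - int b = - (u\<^sup>2)] (mod int n))"
      unfolding quadratic_unitary_Cayley_graph_def by simp_all
    then obtain u :: int where u: "1 \<le> u" "u \<le> int n - 1" "gcd u (int n) = 1"
      and "[int a - int b = u\<^sup>2] (mod int n) \<or> [int a - int b = - (u\<^sup>2)] (mod int n)"
      by metis
    then have "[int b - int a = - (u\<^sup>2)] (mod int n) \<or> [int b - int a = u\<^sup>2] (mod int n)"
      using flip flip' by metis
    then show "(b, a) \<in> arcs_ends ?G"
      using ab u unfolding quadratic_unitary_Cayley_graph_def by auto
  qed
  show ?thesis
    by unfold_locales
      (use sub fin sym in \<open>auto simp: quadratic_unitary_Cayley_graph_def\<close>)
qed

section \<open>Matrix exponential\<close>

text \<open>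
  The entrywise sum of the exponential series, for square matrices; the lemma
  \<open>summable_mat_exp\<close> below shows that the series converges absolutely.
\<close>

definition mat_exp :: "complex mat \<Rightarrow> complex mat" where
  "mat_exp A = mat (dim_row A) (dim_row A)
    (\<lambda>(i, j). \<Sum>k. (A ^\<^sub>m k) $$ (i, j) / fact k)"

lemma summable_mat_exp:
  fixes A :: "complex mat"
  assumes A: "A \<in> carrier_mat n n" and ij: "i < n" "j < n"
  shows "summable (\<lambda>k. norm ((A ^\<^sub>m k) $$ (i, j) / fact k))"
proof -
  obtain b where b: "norm_bound A b"
    using norm_bound_max by blast
  have pow: "norm_bound (A ^\<^sub>m k) ((b * of_nat n) ^ k)" for k
  proof (induction k)
    case 0
    show ?case using A by (auto simp: norm_bound_def)
  next
    case (Suc k)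
    have "norm_bound (A ^\<^sub>m k * A) ((b * of_nat n) ^ k * b * of_nat n)"
      by (rule norm_bound_mult[OF pow_carrier_mat[OF A] A Suc b])
    then show ?case by (simp add: mult_ac)
  qed
  have dims: "dim_row (A ^\<^sub>m k) = n" "dim_col (A ^\<^sub>m k) = n" for k
    using pow_carrier_mat[OF A, of k] by auto
  have entry: "norm ((A ^\<^sub>m k) $$ (i, j)) \<le> (b * of_nat n) ^ k" for k
    using pow[of k, unfolded norm_bound_def dims] ij by blast
  have "norm ((A ^\<^sub>m k) $$ (i, j) / fact k) \<le> (b * of_nat n) ^ k /\<^sub>R fact k" for k
    using entry[of k] by (simp add: norm_divide divide_simps)
  then show ?thesis
    by (intro summable_comparison_test'[OF summable_exp_generic[of "b * of_nat n"]]) auto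
qed

section \<open>Fractional revival\<close>

text \<open>
  Matrices are indexed by the natural numbers below their dimension, so these notions
  are meant for finite graphs whose vertex set is an initial segment \<open>{0..<N}\<close>.
\<close>

definition adjacency_matrix :: "nat pair_pre_digraph \<Rightarrow> complex mat" where
  "adjacency_matrix G = mat (card (pverts G)) (card (pverts G))
    (\<lambda>(a, b). if (a, b) \<in> parcs G then 1 else 0)"

definition transition_matrix :: "nat pair_pre_digraph \<Rightarrow> real \<Rightarrow> complex mat" where
  "transition_matrix G t = mat_exp ((- \<i> * complex_of_real t) \<cdot>\<^sub>m adjacency_matrix G)"

definition fractional_revival :: "nat pair_pre_digraph \<Rightarrow> nat \<Rightarrow> nat \<Rightarrow> bool" where
  "fractional_revival G a b \<longleftrightarrow>
    (let N = card (pverts G) in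
      a \<in> pverts G \<and> b \<in> pverts G \<and> b \<noteq> a \<and>
      (\<exists>t::real. t > 0 \<and>
        (\<exists>\<alpha> \<beta> :: complex. \<beta> \<noteq> 0 \<and> (cmod \<alpha>)\<^sup>2 + (cmod \<beta>)\<^sup>2 = 1 \<and>
          transition_matrix G t *\<^sub>v unit_vec N a
            = \<alpha> \<cdot>\<^sub>v unit_vec N a + \<beta> \<cdot>\<^sub>v unit_vec N b)))"

definition admits_fractional_revival :: "nat pair_pre_digraph \<Rightarrow> bool" where
  "admits_fractional_revival G \<longleftrightarrow> (\<exists>a b. fractional_revival G a b)"

end

theory Submission
  imports Defs "HOL-Analysis.Complex_Transcendental" "HOL-Number_Theory.Number_Theory"
begin

text \<open>
  The characters of \<open>\<int>/n\<close> diagonalise the graph, with eigenvalues \<open>\<lambda>\<^sub>j\<close>. Comparing \<open>j\<close> with \<open>-j\<close> shows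
  that fractional revival at time \<open>t\<close> forces \<open>n\<close> to be even and means that \<open>exp (-it\<lambda>\<^sub>j)\<close> takes one
  value for even and another for odd \<open>j\<close>. For \<open>n > 2\<close> the eigenvalues of each parity sum to zero, so
  they are all rational, hence integers. As in the proof of the irreducibility of cyclotomic
  polynomials, the Frobenius congruence \<open>\<lambda>\<^sub>j\<^sub>p \<equiv> \<lambda>\<^sub>j\<close> modulo large primes \<open>p\<close> then makes the
  eigenvalues, and therefore the connection set, invariant under all units: every unit is a square up
  to sign. This leaves \<open>n = 4\<close> and \<open>n = 2p\<^sup>k\<close> with \<open>p \<equiv> 3\<close> modulo \<open>4\<close>; if \<open>k > 1\<close>, the connection set is
  invariant under translation by \<open>n/p\<close>, so \<open>\<lambda>\<^sub>1 = \<lambda>\<^sub>2 = 0\<close> and the two values coincide.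
\<close>

section \<open>Additive characters and periodic sums\<close>

text \<open>The second argument is an integer, not a residue, so that differences of vertices and
  multiples by units can be inserted without reduction.\<close>

definition additive_char :: "nat \<Rightarrow> int \<Rightarrow> complex" where
  "additive_char n k = cis (2 * pi * real_of_int k / real n)"

lemma additive_char_0 [simp]: "additive_char n 0 = 1"
  by (simp add: additive_char_def)

lemma additive_char_nonzero [simp]: "additive_char n k \<noteq> 0"
  by (simp add: additive_char_def)

lemma norm_additive_char [simp]: "norm (additive_char n k) = 1"
  by (simp add: additive_char_def)

lemma additive_char_add: "additive_char n (k + l) = additive_char n k * additive_char n l"
  by (simp add: additive_char_def cis_mult add_divide_distrib ring_distribs)

lemma additive_char_power: "additive_char n k ^ m = additive_char n (int m * k)"
  by (simp add: additive_char_def Complex.DeMoivre mult_ac)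

lemma additive_char_eq_1_iff:
  assumes "n > 0"
  shows "additive_char n k = 1 \<longleftrightarrow> int n dvd k"
proof -
  have "additive_char n k = 1 \<longleftrightarrow> (\<exists>m::int. 2 * pi * real_of_int k / real n = of_int (2 * m) * pi)"
    by (simp add: additive_char_def cis_conv_exp exp_eq_1)
  also have "\<dots> \<longleftrightarrow> (\<exists>m::int. real_of_int k = real_of_int (int n * m))"
    using assms by (simp add: field_simps)
  also have "\<dots> \<longleftrightarrow> int n dvd k"
    unfolding of_int_eq_iff dvd_def ..
  finally show ?thesis .
qed

lemma additive_char_add_multiple:
  assumes "n > 0"
  shows "additive_char n (k + int n * l) = additive_char n k"
  using assms by (simp add: additive_char_add additive_char_eq_1_iff)

text \<open>Orthogonality of characters: unless \<open>h\<close> divides \<open>x\<close>, this is a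
  geometric series whose ratio is an \<open>h\<close>-th root of unity other than 1.\<close>

lemma sum_additive_char:
  assumes "h > 0"
  shows "(\<Sum>i<h. additive_char h (int i * x)) = (if int h dvd x then of_nat h else 0)"
proof (cases "int h dvd x")
  case True
  then have "additive_char h (int i * x) = 1" for i
    using assms by (simp add: additive_char_eq_1_iff)
  then show ?thesis using True by simp
next
  case False
  define z where "z = additive_char h x"
  have "z \<noteq> 1" using False assms by (simp add: z_def additive_char_eq_1_iff)
  have "(\<Sum>i<h. additive_char h (int i * x)) = (\<Sum>i<h. z ^ i)"
    by (simp add: z_def additive_char_power)
  also have "\<dots> = (z ^ h - 1) / (z - 1)"
    by (rule geometric_sum[OF \<open>z \<noteq> 1\<close>])
  also have "z ^ h = 1"
    using assms by (simp add: z_def additive_char_power additive_char_eq_1_iff)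
  finally show ?thesis using False by simp
qed

text \<open>Functions on the residue ring are encoded as periodic functions on the integers; sums
  over the ring become sums over \<open>x < n\<close>.\<close>

definition periodic_int :: "nat \<Rightarrow> (int \<Rightarrow> 'a) \<Rightarrow> bool" where
  "periodic_int n g \<longleftrightarrow> (\<forall>x y. [x = y] (mod int n) \<longrightarrow> g x = g y)"

lemma periodic_int_additive_char:
  assumes "n > 0"
  shows "periodic_int n (\<lambda>x. additive_char n (c * x))"
  unfolding periodic_int_def
proof (intro allI impI)
  fix x y :: int
  assume "[x = y] (mod int n)"
  then obtain k where "y = x + int n * k"
    by (auto simp: cong_iff_lin)
  then have "c * y = c * x + int n * (c * k)"
    by (simp add: algebra_simps)
  then show "additive_char n (c * x) = additive_char n (c * y)"
    using additive_char_add_multiple[OF assms] by metis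
qed

text \<open>An affine map with unit slope permutes the residues. It is applied with slope -1
  (negation), slope 1 (translations) and arbitrary units.\<close>

lemma sum_periodic_affine:
  fixes g :: "int \<Rightarrow> 'a :: comm_monoid_add"
  assumes "n > 0" and g: "periodic_int n g" and c: "coprime c (int n)"
  shows "(\<Sum>x<n. g (c * int x + a)) = (\<Sum>x<n. g (int x))"
proof -
  define h where "h x = nat ((c * int x + a) mod int n)" for x
  have h: "int (h x) = (c * int x + a) mod int n" for x
    using \<open>n > 0\<close> by (simp add: h_def)
  have inj: "inj_on h {..<n}"
  proof
    fix x y assume xy: "x \<in> {..<n}" "y \<in> {..<n}" "h x = h y"
    then have "[c * int x + a = c * int y + a] (mod int n)"
      using h[of x] h[of y] by (simp add: cong_def)
    then have "[c * int x = c * int y] (mod int n)"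
      by (simp only: cong_add_rcancel)
    then have "[int x = int y] (mod int n)"
      using cong_mult_lcancel[OF c] by simp
    then show "x = y" using xy by (simp add: cong_def)
  qed
  have sub: "h ` {..<n} \<subseteq> {..<n}"
    using \<open>n > 0\<close> by (auto simp: h_def nat_less_iff)
  have bij: "bij_betw h {..<n} {..<n}"
    unfolding bij_betw_def using inj endo_inj_surj[OF _ sub inj] by simp
  have "g (c * int x + a) = g (int (h x))" for x
  proof -
    have "[c * int x + a = int (h x)] (mod int n)" by (simp add: h cong_def)
    then show ?thesis using g unfolding periodic_int_def by blast
  qed
  then have "(\<Sum>x<n. g (c * int x + a)) = (\<Sum>x<n. g (int (h x)))" by simp
  also have "\<dots> = (\<Sum>x<n. g (int x))"
    by (rule sum.reindex_bij_betw[OF bij])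
  finally show ?thesis .
qed

text \<open>Injectivity of the discrete Fourier transform: weighting the \<open>j\<close>-th sum
  with the inverse character at \<open>y\<close> and summing over \<open>j\<close> isolates
  \<open>n * w y\<close> by orthogonality.\<close>

lemma character_sums_eq_0_imp_eq_0:
  fixes w :: "nat \<Rightarrow> complex"
  assumes w: "\<And>j. j < n \<Longrightarrow> (\<Sum>x<n. additive_char n (int j * int x) * w x) = 0" and y: "y < n"
  shows "w y = 0"
proof -
  have "n > 0" using y by simp
  have dvd: "int n dvd int x - int y \<longleftrightarrow> x = y" if "x < n" for x
    using that y by (metis cong_iff_dvd_diff cong_def mod_less zmod_int of_nat_eq_iff)
  have "0 = (\<Sum>j<n. additive_char n (- int j * int y) * (\<Sum>x<n. additive_char n (int j * int x) * w x))"
    by (simp add: w)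
  also have "\<dots> = (\<Sum>j<n. \<Sum>x<n. additive_char n (int j * (int x - int y)) * w x)"
    unfolding sum_distrib_left mult.assoc[symmetric] additive_char_add[symmetric]
    by (simp add: algebra_simps)
  also have "\<dots> = (\<Sum>x<n. (\<Sum>j<n. additive_char n (int j * (int x - int y))) * w x)"
    by (subst sum.swap) (simp add: sum_distrib_right)
  also have "\<dots> = (\<Sum>x<n. if x = y then of_nat n * w x else 0)"
    by (intro sum.cong) (use dvd in \<open>auto simp: sum_additive_char[OF \<open>n > 0\<close>]\<close>)
  also have "\<dots> = of_nat n * w y"
    using y by simp
  finally show ?thesis using \<open>n > 0\<close> by simp
qed

section \<open>Lifting units\<close>

text \<open>Take \<open>b = a + d * k\<close>, where \<open>k\<close> is the product of the primes
  of \<open>N\<close> dividing neither \<open>a\<close> nor \<open>d\<close>. Every prime divisor of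
  \<open>N\<close> then divides exactly one of \<open>a\<close> and \<open>d * k\<close>, hence not
  their sum.\<close>

lemma coprime_lift:
  fixes a d N :: int
  assumes "coprime a d" "N > 0"
  obtains b where "[b = a] (mod d)" "coprime b N"
proof -
  define S where "S = {q \<in> prime_factors N. \<not> q dvd a \<and> \<not> q dvd d}"
  define k where "k = \<Prod>S"
  have fin: "finite S" by (simp add: S_def)
  have k: "q dvd k \<longleftrightarrow> q \<in> S" if "q \<in> prime_factors N" for q
  proof
    assume "q dvd k"
    moreover have "prime q" using that by (rule in_prime_factors_imp_prime)
    ultimately obtain r where r: "r \<in> S" "q dvd r"
      using prime_dvd_prod_iff[OF fin, of q "\<lambda>x. x"] unfolding k_def by auto
    then have "q = r"
      using that by (intro primes_dvd_imp_eq) (auto simp: S_def)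
    then show "q \<in> S" using r by simp
  next
    assume "q \<in> S" then show "q dvd k"
      unfolding k_def using dvd_prodI[OF fin, of q "\<lambda>x. x"] by simp
  qed
  have "coprime (a + d * k) N"
  proof (rule ccontr)
    assume "\<not> coprime (a + d * k) N"
    then have "\<not> is_unit (gcd (a + d * k) N)" using coprime_iff_gcd_eq_1 by auto
    moreover have "gcd (a + d * k) N \<noteq> 0" using \<open>N > 0\<close> by simp
    ultimately obtain q where "prime q" "q dvd gcd (a + d * k) N"
      using prime_divisor_exists by blast
    then have q: "prime q" "q dvd a + d * k" "q dvd N" by simp_all
    then have qN: "q \<in> prime_factors N"
      using \<open>N > 0\<close> by (simp add: in_prime_factors_iff)
    show False
    proof (cases "q dvd a")
      case True
      then have "q dvd d * k" using q(2) by (simp add: dvd_add_right_iff)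
      moreover have "\<not> q dvd d"
        using assms(1) True q(1) by (meson coprime_common_divisor not_prime_unit)
      ultimately have "q dvd k" using q(1) by (simp add: prime_dvd_mult_iff)
      then show False using k[OF qN] True by (simp add: S_def)
    next
      case False
      then have "\<not> q dvd d * k" using q(2) by (metis dvd_add_left_iff)
      then show False
        using k[OF qN] False qN by (auto simp: S_def)
    qed
  qed
  moreover have "[a + d * k = a] (mod d)" by (simp add: cong_def)
  ultimately show ?thesis using that by blast
qed

section \<open>Algebraic integers as eigenvalues of integer matrices\<close>

text \<open>
  For a fixed vector \<open>v\<close>, the numbers \<open>x\<close> with \<open>M v = x v\<close> for some integer matrix \<open>M\<close> form a
  ring of algebraic integers; this is all the closure of algebraic integers that is needed.
\<close>

definition int_eigenvalue :: "nat \<Rightarrow> complex Matrix.vec \<Rightarrow> complex \<Rightarrow> bool" where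
  "int_eigenvalue n v x \<longleftrightarrow>
    (\<exists>M \<in> carrier_mat n n. map_mat complex_of_int M *\<^sub>v v = x \<cdot>\<^sub>v v)"

lemma int_eigenvalue_add:
  assumes v: "v \<in> carrier_vec n" and "int_eigenvalue n v x" "int_eigenvalue n v y"
  shows "int_eigenvalue n v (x + y)"
proof -
  obtain M N where M: "M \<in> carrier_mat n n" "map_mat complex_of_int M *\<^sub>v v = x \<cdot>\<^sub>v v"
    and N: "N \<in> carrier_mat n n" "map_mat complex_of_int N *\<^sub>v v = y \<cdot>\<^sub>v v"
    using assms unfolding int_eigenvalue_def by blast
  have "map_mat complex_of_int (M + N) = map_mat complex_of_int M + map_mat complex_of_int N"
    using M N by (intro eq_matI) auto
  then have "map_mat complex_of_int (M + N) *\<^sub>v v = (x + y) \<cdot>\<^sub>v v"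
    using M N v by (simp add: add_mult_distrib_mat_vec[of _ n n] add_smult_distrib_vec)
  then show ?thesis
    using M(1) N(1) unfolding int_eigenvalue_def by (intro bexI[of _ "M + N"]) auto
qed

lemma int_eigenvalue_mult:
  assumes v: "v \<in> carrier_vec n" and "int_eigenvalue n v x" "int_eigenvalue n v y"
  shows "int_eigenvalue n v (x * y)"
proof -
  obtain M N where M: "M \<in> carrier_mat n n" "map_mat complex_of_int M *\<^sub>v v = x \<cdot>\<^sub>v v"
    and N: "N \<in> carrier_mat n n" "map_mat complex_of_int N *\<^sub>v v = y \<cdot>\<^sub>v v"
    using assms unfolding int_eigenvalue_def by blast
  have "map_mat complex_of_int (M * N) *\<^sub>v v
      = map_mat complex_of_int M *\<^sub>v (map_mat complex_of_int N *\<^sub>v v)"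
    using M N v
    by (simp add: of_int_hom.mat_hom_mult[OF M(1) N(1)] assoc_mult_mat_vec[of _ n n _ n])
  also have "\<dots> = (x * y) \<cdot>\<^sub>v v"
    using M N v by (simp add: mult_mat_vec[of _ n n] smult_smult_assoc mult.commute)
  finally show ?thesis
    using M(1) N(1) unfolding int_eigenvalue_def by (intro bexI[of _ "M * N"]) auto
qed

lemma int_eigenvalue_of_int:
  assumes v: "v \<in> carrier_vec n"
  shows "int_eigenvalue n v (of_int c)"
proof -
  have "map_mat complex_of_int (c \<cdot>\<^sub>m 1\<^sub>m n) = of_int c \<cdot>\<^sub>m 1\<^sub>m n"
    by (intro eq_matI) auto
  then have "map_mat complex_of_int (c \<cdot>\<^sub>m 1\<^sub>m n) *\<^sub>v v = of_int c \<cdot>\<^sub>v v"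
    using v by (intro eq_vecI) (auto simp: smult_scalar_prod_distrib)
  then show ?thesis
    unfolding int_eigenvalue_def by (intro bexI[of _ "c \<cdot>\<^sub>m 1\<^sub>m n"]) auto
qed

lemma int_eigenvalue_sum:
  assumes v: "v \<in> carrier_vec n" and "\<And>i. i \<in> I \<Longrightarrow> int_eigenvalue n v (f i)"
  shows "int_eigenvalue n v (sum f I)"
  using assms(2)
  by (induction I rule: infinite_finite_induct)
    (auto intro: int_eigenvalue_add[OF v] simp: int_eigenvalue_of_int[OF v, of 0, simplified])

lemma int_eigenvalue_power:
  assumes v: "v \<in> carrier_vec n" and "int_eigenvalue n v x"
  shows "int_eigenvalue n v (x ^ k)"
  by (induction k)
    (auto intro: int_eigenvalue_mult[OF v] assms simp: int_eigenvalue_of_int[OF v, of 1, simplified])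

text \<open>Such an \<open>x\<close> is a root of the characteristic polynomial of an integer
  matrix, which is monic with integer coefficients; rational algebraic integers are
  integers.\<close>

lemma rational_int_eigenvalue_is_int:
  assumes v: "v \<in> carrier_vec n" "v \<noteq> 0\<^sub>v n" and "int_eigenvalue n v x" "x \<in> \<rat>"
  shows "x \<in> \<int>"
proof -
  obtain M where M: "M \<in> carrier_mat n n" "map_mat complex_of_int M *\<^sub>v v = x \<cdot>\<^sub>v v"
    using assms unfolding int_eigenvalue_def by blast
  have "eigenvalue (map_mat complex_of_int M) x"
    unfolding eigenvalue_def eigenvector_def using M v by auto
  then have "poly (char_poly (map_mat complex_of_int M)) x = 0"
    using eigenvalue_root_char_poly M(1) by (metis map_carrier_mat)
  then have "poly (map_poly of_int (char_poly M)) x = 0"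
    by (simp add: of_int_hom.char_poly_hom[OF M(1)])
  moreover have "lead_coeff (char_poly M) = 1"
    using degree_monic_char_poly[OF M(1)] by auto
  ultimately have "algebraic_int x"
    unfolding algebraic_int_altdef_ipoly by blast
  then show ?thesis
    using rational_algebraic_int_is_int \<open>x \<in> \<rat>\<close> by blast
qed

text \<open>The Frobenius congruence modulo \<open>p\<close>, with the quotient \<open>r\<close>
  kept in the ring of algebraic integers attached to \<open>v\<close>, so that \<open>r\<close> is
  an integer as soon as it is rational.\<close>

lemma int_eigenvalue_frobenius:
  assumes v: "v \<in> carrier_vec n" and "prime p" and "finite I"
    and f: "\<And>i. i \<in> I \<Longrightarrow> int_eigenvalue n v (f i)"
  shows "\<exists>r. int_eigenvalue n v r \<and> (\<Sum>i\<in>I. f i) ^ p = (\<Sum>i\<in>I. f i ^ p) + of_nat p * r"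
  using \<open>finite I\<close> f
proof (induction I rule: finite_induct)
  case empty
  have "int_eigenvalue n v 0" using int_eigenvalue_of_int[OF v, of 0] by simp
  then show ?case using prime_gt_0_nat[OF \<open>prime p\<close>] by (auto intro!: exI[of _ 0] simp: power_0_left)
next
  case (insert i I)
  then obtain r where r: "int_eigenvalue n v r" "(\<Sum>i\<in>I. f i) ^ p = (\<Sum>i\<in>I. f i ^ p) + of_nat p * r"
    by auto
  define a b where "a = f i" and "b = (\<Sum>i\<in>I. f i)"
  have a: "int_eigenvalue n v a" and b: "int_eigenvalue n v b"
    using insert.prems by (auto simp: a_def b_def intro!: int_eigenvalue_sum[OF v])
  \<comment> \<open>The middle binomial terms divided by \<open>p\<close>; their coefficients stay
    integral, so their sum \<open>s\<close> stays in the ring.\<close>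
  define g where "g k = of_int (int ((p choose k) div p)) * (a ^ k * b ^ (p - k))" for k
  define s where "s = (\<Sum>k\<in>{0<..<p}. g k)"
  have "p > 0" using \<open>prime p\<close> by (simp add: prime_gt_0_nat)
  have s: "int_eigenvalue n v s"
    unfolding s_def g_def
    by (intro int_eigenvalue_sum int_eigenvalue_mult int_eigenvalue_of_int int_eigenvalue_power v a b)
  have g: "of_nat (p choose k) * a ^ k * b ^ (p - k) = of_nat p * g k" if "k \<in> {0<..<p}" for k
  proof -
    have "p dvd p choose k" using that \<open>prime p\<close> by (intro dvd_choose_prime) auto
    then have "p * ((p choose k) div p) = p choose k" by simp
    then have "of_nat p * of_nat ((p choose k) div p) = (of_nat (p choose k) :: complex)"
      by (metis of_nat_mult)
    then show ?thesis by (simp add: g_def mult_ac)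
  qed
  have split: "{..p} = insert 0 (insert p {0<..<p})" using \<open>p > 0\<close> by auto
  have "(a + b) ^ p = (\<Sum>k\<le>p. of_nat (p choose k) * a ^ k * b ^ (p - k))"
    by (rule binomial_ring)
  also have "\<dots> = a ^ p + b ^ p + (\<Sum>k\<in>{0<..<p}. of_nat (p choose k) * a ^ k * b ^ (p - k))"
    unfolding split using \<open>p > 0\<close> by simp
  also have "(\<Sum>k\<in>{0<..<p}. of_nat (p choose k) * a ^ k * b ^ (p - k)) = of_nat p * s"
    unfolding s_def sum_distrib_left by (intro sum.cong g refl)
  finally have "(a + b) ^ p = a ^ p + b ^ p + of_nat p * s" .
  then have "(\<Sum>i\<in>insert i I. f i) ^ p = (\<Sum>i\<in>insert i I. f i ^ p) + of_nat p * (r + s)"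
    using insert.hyps r(2) by (simp add: a_def b_def algebra_simps)
  then show ?case using int_eigenvalue_add[OF v r(1) s] by blast
qed

section \<open>The spectrum of the quadratic unitary Cayley graph\<close>

text \<open>The connection set as a predicate on all integers, with \<open>u\<close> any integer
  representing a unit; this makes it periodic modulo \<open>n\<close>.\<close>

definition pm_unit_square :: "nat \<Rightarrow> int \<Rightarrow> bool" where
  "pm_unit_square n d \<longleftrightarrow>
    (\<exists>u::int. coprime u (int n) \<and> ([d = u\<^sup>2] (mod int n) \<or> [d = - (u\<^sup>2)] (mod int n)))"

lemma pm_unit_square_cong:
  assumes "[d = d'] (mod int n)"
  shows "pm_unit_square n d \<longleftrightarrow> pm_unit_square n d'"
proof -
  have "[d = c] (mod int n) \<longleftrightarrow> [d' = c] (mod int n)" for c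
    using assms by (simp add: cong_def)
  then show ?thesis unfolding pm_unit_square_def by simp
qed

lemma pm_unit_square_uminus: "pm_unit_square n (- d) \<longleftrightarrow> pm_unit_square n d"
proof -
  have "[- d = c] (mod int n) \<longleftrightarrow> [d = - c] (mod int n)" for c
    using cong_minus_minus_iff[of d "- c" "int n"] by simp
  then show ?thesis unfolding pm_unit_square_def by auto
qed

lemma pm_unit_square_1: "pm_unit_square n 1"
  unfolding pm_unit_square_def by (intro exI[of _ 1]) simp

lemma pm_unit_square_imp_coprime:
  assumes "pm_unit_square n d"
  shows "coprime d (int n)"
proof -
  obtain u where u: "coprime u (int n)" "[d = u\<^sup>2] (mod int n) \<or> [d = - (u\<^sup>2)] (mod int n)"
    using assms unfolding pm_unit_square_def by blast
  then have "coprime (u\<^sup>2) (int n)" "coprime (- (u\<^sup>2)) (int n)" by simp_all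
  then show ?thesis using u(2) by (metis cong_imp_coprime cong_sym)
qed

text \<open>Reducing \<open>u\<close> modulo \<open>n\<close> brings it into the range required of
  an arc. For \<open>n \<ge> 2\<close> zero is not a unit, which gives both
  \<open>v \<noteq> 0\<close> and \<open>a \<noteq> b\<close>; for \<open>n = 1\<close> the
  equivalence fails, since the single vertex has no loop.\<close>

lemma parcs_quadratic_unitary_Cayley_graph:
  assumes "n \<ge> 2" "a < n" "b < n"
  shows "(a, b) \<in> parcs (quadratic_unitary_Cayley_graph n) \<longleftrightarrow> pm_unit_square n (int a - int b)"
proof
  assume "(a, b) \<in> parcs (quadratic_unitary_Cayley_graph n)"
  then have "\<exists>u::int. 1 \<le> u \<and> u \<le> int n - 1 \<and> gcd u (int n) = 1 \<and>
      ([int a - int b = u\<^sup>2] (mod int n) \<or> [int a - int b = - (u\<^sup>2)] (mod int n))"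
    unfolding quadratic_unitary_Cayley_graph_def by simp
  then show "pm_unit_square n (int a - int b)"
    unfolding pm_unit_square_def coprime_iff_gcd_eq_1 by (elim ex_forward) simp
next
  assume P: "pm_unit_square n (int a - int b)"
  have "a \<noteq> b"
    using pm_unit_square_imp_coprime[OF P] \<open>n \<ge> 2\<close> by auto
  obtain u where u: "coprime u (int n)"
      "[int a - int b = u\<^sup>2] (mod int n) \<or> [int a - int b = - (u\<^sup>2)] (mod int n)"
    using P unfolding pm_unit_square_def by blast
  define v where "v = u mod int n"
  have v: "[u = v] (mod int n)" by (simp add: v_def cong_def)
  have cop: "coprime v (int n)"
    using u(1) v cong_imp_coprime by blast
  have "v \<noteq> 0" using cop \<open>n \<ge> 2\<close> by auto
  moreover have "0 \<le> v" "v < int n" using \<open>n \<ge> 2\<close> by (simp_all add: v_def)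
  ultimately have "1 \<le> v" "v \<le> int n - 1" by auto
  moreover have "[int a - int b = v\<^sup>2] (mod int n) \<or> [int a - int b = - (v\<^sup>2)] (mod int n)"
    using u(2) v by (metis cong_pow cong_trans cong_minus_minus_iff)
  ultimately show "(a, b) \<in> parcs (quadratic_unitary_Cayley_graph n)"
    using assms \<open>a \<noteq> b\<close> cop unfolding quadratic_unitary_Cayley_graph_def coprime_iff_gcd_eq_1
    by auto
qed

text \<open>The Fourier transform of the indicator of the connection set, that is,
  \<open>\<lambda>\<^sub>j\<close>. It is complex-valued so that it can be handled together with
  roots of unity.\<close>

definition quc_eigenvalue :: "nat \<Rightarrow> int \<Rightarrow> complex" where
  "quc_eigenvalue n j = (\<Sum>x<n. if pm_unit_square n (int x) then additive_char n (j * int x) else 0)"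

lemma periodic_int_quc_summand:
  assumes "n > 0"
  shows "periodic_int n (\<lambda>x. if pm_unit_square n x then additive_char n (j * x) else 0)"
  unfolding periodic_int_def
proof (intro allI impI)
  fix x y :: int
  assume xy: "[x = y] (mod int n)"
  then have "additive_char n (j * x) = additive_char n (j * y)"
    using periodic_int_additive_char[OF assms] unfolding periodic_int_def by blast
  then show "(if pm_unit_square n x then additive_char n (j * x) else 0)
      = (if pm_unit_square n y then additive_char n (j * y) else 0)"
    using pm_unit_square_cong[OF xy] by simp
qed

lemma quc_eigenvalue_cong:
  assumes "n > 0" "[j = k] (mod int n)"
  shows "quc_eigenvalue n j = quc_eigenvalue n k"
proof -
  have "additive_char n (int x * j) = additive_char n (int x * k)" for x
    using periodic_int_additive_char[OF assms(1)] assms(2) unfolding periodic_int_def by blast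
  then show ?thesis
    unfolding quc_eigenvalue_def by (metis (no_types, lifting) mult.commute)
qed

text \<open>The connection set is closed under negation.\<close>

lemma quc_eigenvalue_uminus:
  assumes "n > 0"
  shows "quc_eigenvalue n (- j) = quc_eigenvalue n j"
proof -
  let ?g = "\<lambda>x. if pm_unit_square n x then additive_char n (j * x) else 0"
  have "quc_eigenvalue n (- j) = (\<Sum>x<n. ?g (- 1 * int x + 0))"
    unfolding quc_eigenvalue_def by (intro sum.cong) (auto simp: pm_unit_square_uminus)
  also have "\<dots> = quc_eigenvalue n j"
    unfolding quc_eigenvalue_def
    by (rule sum_periodic_affine[OF assms periodic_int_quc_summand[OF assms]]) simp
  finally show ?thesis .
qed

lemma norm_quc_eigenvalue_le: "norm (quc_eigenvalue n j) \<le> n"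
proof -
  have "norm (quc_eigenvalue n j) \<le> (\<Sum>x<n. 1)"
    unfolding quc_eigenvalue_def by (intro sum_norm_le) auto
  then show ?thesis by simp
qed

text \<open>The eigenvalue at 0 counts the connection set, which contains 1. It is the known nonzero
  integer from which rationality of the whole spectrum is deduced.\<close>

lemma quc_eigenvalue_0_nonzero:
  assumes "n \<ge> 2"
  shows "\<exists>m. m > 0 \<and> quc_eigenvalue n 0 = of_nat m"
proof -
  have eq: "quc_eigenvalue n 0 = of_nat (card {x\<in>{..<n}. pm_unit_square n (int x)})"
    unfolding quc_eigenvalue_def by (simp add: sum.inter_filter[symmetric])
  have "1 \<in> {x\<in>{..<n}. pm_unit_square n (int x)}"
    using assms pm_unit_square_1 by simp
  then have "card {x\<in>{..<n}. pm_unit_square n (int x)} > 0"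
    by (subst card_gt_0_iff) auto
  with eq show ?thesis by blast
qed

section \<open>Adjacency and transition matrices in the basis of characters\<close>

lemma adjacency_matrix_quc_carrier:
  "adjacency_matrix (quadratic_unitary_Cayley_graph n) \<in> carrier_mat n n"
  by (simp add: adjacency_matrix_def quadratic_unitary_Cayley_graph_def)

lemma adjacency_matrix_quc_entry:
  assumes "n \<ge> 2" "a < n" "b < n"
  shows "adjacency_matrix (quadratic_unitary_Cayley_graph n) $$ (a, b)
    = (if pm_unit_square n (int a - int b) then 1 else 0)"
proof -
  have "card (pverts (quadratic_unitary_Cayley_graph n)) = n"
    by (simp add: quadratic_unitary_Cayley_graph_def)
  then show ?thesis
    using assms by (simp add: adjacency_matrix_def parcs_quadratic_unitary_Cayley_graph)
qed

text \<open>Translating the summation variable by \<open>a\<close> pulls out the character value at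
  \<open>a\<close>. Left eigenvectors are used because they can be paired directly with column
  \<open>a\<close> of the transition matrix.\<close>

lemma adjacency_matrix_quc_row_eigenvector:
  assumes "n \<ge> 2" "a < n"
  shows "(\<Sum>x<n. additive_char n (j * int x) *
      adjacency_matrix (quadratic_unitary_Cayley_graph n) $$ (x, a))
    = quc_eigenvalue n j * additive_char n (j * int a)"
proof -
  have "n > 0" using assms by simp
  let ?g = "\<lambda>x. if pm_unit_square n x then additive_char n (j * x) else 0"
  have "additive_char n (j * int x) * adjacency_matrix (quadratic_unitary_Cayley_graph n) $$ (x, a)
      = ?g (1 * int x + (- int a)) * additive_char n (j * int a)" if "x < n" for x
    using that assms
    by (simp add: adjacency_matrix_quc_entry additive_char_add[symmetric] algebra_simps)
  then have "(\<Sum>x<n. additive_char n (j * int x) *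
      adjacency_matrix (quadratic_unitary_Cayley_graph n) $$ (x, a))
    = (\<Sum>x<n. ?g (1 * int x + (- int a))) * additive_char n (j * int a)"
    by (simp add: sum_distrib_right)
  also have "(\<Sum>x<n. ?g (1 * int x + (- int a))) = quc_eigenvalue n j"
    unfolding quc_eigenvalue_def
    by (rule sum_periodic_affine[OF \<open>n > 0\<close> periodic_int_quc_summand[OF \<open>n > 0\<close>]]) simp
  finally show ?thesis .
qed

lemma pow_mat_row_eigenvector:
  fixes A :: "'a :: comm_ring_1 mat"
  assumes A: "A \<in> carrier_mat n n"
    and ev: "\<And>a. a < n \<Longrightarrow> (\<Sum>x<n. v x * A $$ (x, a)) = l * v a" and "a < n"
  shows "(\<Sum>x<n. v x * (A ^\<^sub>m k) $$ (x, a)) = l ^ k * v a"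
  using \<open>a < n\<close>
proof (induction k arbitrary: a)
  case 0
  have "(\<Sum>x<n. v x * (A ^\<^sub>m 0) $$ (x, a)) = (\<Sum>x<n. if x = a then v x else 0)"
    using 0 A by (intro sum.cong) auto
  then show ?case using 0 by simp
next
  case (Suc k)
  have "(A ^\<^sub>m Suc k) $$ (x, a) = (\<Sum>y<n. (A ^\<^sub>m k) $$ (x, y) * A $$ (y, a))" if "x < n" for x
    using that Suc.prems A pow_carrier_mat[OF A, of k]
    by (simp add: scalar_prod_def atLeast0LessThan)
  then have "(\<Sum>x<n. v x * (A ^\<^sub>m Suc k) $$ (x, a))
      = (\<Sum>x<n. \<Sum>y<n. v x * (A ^\<^sub>m k) $$ (x, y) * A $$ (y, a))"
    by (simp add: sum_distrib_left mult.assoc)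
  also have "\<dots> = (\<Sum>y<n. (\<Sum>x<n. v x * (A ^\<^sub>m k) $$ (x, y)) * A $$ (y, a))"
    by (subst sum.swap) (simp add: sum_distrib_right)
  also have "\<dots> = (\<Sum>y<n. l ^ k * (v y * A $$ (y, a)))"
    by (intro sum.cong) (simp_all add: Suc.IH mult.assoc)
  also have "\<dots> = l ^ Suc k * v a"
    unfolding sum_distrib_left[symmetric] by (simp add: ev Suc.prems mult_ac)
  finally show ?case .
qed

text \<open>A finite linear combination of entries commutes with the convergent entrywise series, so
  the claim reduces to powers of \<open>A\<close> and the scalar exponential series.\<close>

lemma mat_exp_row_eigenvector:
  fixes A :: "complex mat"
  assumes A: "A \<in> carrier_mat n n"
    and ev: "\<And>a. a < n \<Longrightarrow> (\<Sum>x<n. v x * A $$ (x, a)) = l * v a" and a: "a < n"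
  shows "(\<Sum>x<n. v x * mat_exp A $$ (x, a)) = exp l * v a"
proof -
  have sm: "summable (\<lambda>k. (A ^\<^sub>m k) $$ (x, a) / fact k)" if "x < n" for x
    by (rule summable_norm_cancel) (rule summable_mat_exp[OF A that a])
  have "(\<Sum>x<n. v x * mat_exp A $$ (x, a)) = (\<Sum>x<n. \<Sum>k. v x * ((A ^\<^sub>m k) $$ (x, a) / fact k))"
    using A a sm by (intro sum.cong) (auto simp: mat_exp_def suminf_mult simp del: times_divide_eq_right)
  also have "\<dots> = (\<Sum>k. \<Sum>x<n. v x * ((A ^\<^sub>m k) $$ (x, a) / fact k))"
    proof (rule suminf_sum[symmetric])
    fix x assume "x \<in> {..<n}"
    then show "summable (\<lambda>k. v x * ((A ^\<^sub>m k) $$ (x, a) / fact k))"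
      by (intro summable_mult sm) simp
  qed
  also have "\<dots> = (\<Sum>k. (l ^ k /\<^sub>R fact k) * v a)"
  proof (intro suminf_cong)
    fix k
    have "(\<Sum>x<n. v x * ((A ^\<^sub>m k) $$ (x, a) / fact k)) = (\<Sum>x<n. v x * (A ^\<^sub>m k) $$ (x, a)) / fact k"
      by (simp add: sum_divide_distrib)
    then show "(\<Sum>x<n. v x * ((A ^\<^sub>m k) $$ (x, a) / fact k)) = (l ^ k /\<^sub>R fact k) * v a"
      using pow_mat_row_eigenvector[OF A ev a]
      by (simp add: scaleR_conv_of_real divide_inverse mult_ac)
  qed
  also have "\<dots> = exp l * v a"
    using sums_mult2[OF exp_converges[of l], of "v a"] by (rule sums_unique[symmetric])
  finally show ?thesis .
qed

lemma transition_matrix_quc_row_eigenvector: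
  assumes "n \<ge> 2" "a < n"
  shows "(\<Sum>x<n. additive_char n (j * int x) *
      transition_matrix (quadratic_unitary_Cayley_graph n) t $$ (x, a))
    = exp (- \<i> * of_real t * quc_eigenvalue n j) * additive_char n (j * int a)"
  unfolding transition_matrix_def
proof (rule mat_exp_row_eigenvector[OF smult_carrier_mat[OF adjacency_matrix_quc_carrier] _ assms(2)])
  fix a assume "a < n"
  let ?A = "adjacency_matrix (quadratic_unitary_Cayley_graph n)"
  let ?c = "- \<i> * complex_of_real t"
  have "(\<Sum>x<n. additive_char n (j * int x) * (?c \<cdot>\<^sub>m ?A) $$ (x, a))
      = ?c * (\<Sum>x<n. additive_char n (j * int x) * ?A $$ (x, a))"
    unfolding sum_distrib_left
    using adjacency_matrix_quc_carrier[of n] \<open>a < n\<close> by (intro sum.cong) auto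
  then show "(\<Sum>x<n. additive_char n (j * int x) * (?c \<cdot>\<^sub>m ?A) $$ (x, a))
      = ?c * quc_eigenvalue n j * additive_char n (j * int a)"
    by (simp add: adjacency_matrix_quc_row_eigenvector[OF \<open>n \<ge> 2\<close> \<open>a < n\<close>] mult.assoc)
qed

text \<open>Both sides are compared through their Fourier transforms, which determine a vector; the
  transform of column \<open>a\<close> of the transition matrix is known from the row
  eigenvectors.\<close>

lemma transition_matrix_quc_column_iff:
  assumes "n \<ge> 2" "a < n" "b < n"
  shows "transition_matrix (quadratic_unitary_Cayley_graph n) t *\<^sub>v unit_vec n a
      = \<alpha> \<cdot>\<^sub>v unit_vec n a + \<beta> \<cdot>\<^sub>v unit_vec n b \<longleftrightarrow>
    (\<forall>j. exp (- \<i> * of_real t * quc_eigenvalue n j) = \<alpha> + \<beta> * additive_char n (j * (int b - int a)))"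
    (is "?H *\<^sub>v _ = ?w \<longleftrightarrow> ?R")
proof -
  have H: "?H \<in> carrier_mat n n"
    using adjacency_matrix_quc_carrier[of n] by (simp add: transition_matrix_def mat_exp_def)
  \<comment> \<open>The defect between column \<open>a\<close> and the target vector.\<close>
  define w where "w x = ?H $$ (x, a) - (if x = a then \<alpha> else 0) - (if x = b then \<beta> else 0)" for x
  have col: "(\<Sum>x<n. additive_char n (j * int x) * w x) = additive_char n (j * int a) *
    (exp (- \<i> * of_real t * quc_eigenvalue n j) - (\<alpha> + \<beta> * additive_char n (j * (int b - int a))))" for j
  proof -
    have "(\<Sum>x<n. additive_char n (j * int x) * w x)
      = (\<Sum>x<n. additive_char n (j * int x) * ?H $$ (x, a))
        - (\<Sum>x<n. if x = a then \<alpha> * additive_char n (j * int x) else 0)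
        - (\<Sum>x<n. if x = b then \<beta> * additive_char n (j * int x) else 0)"
      unfolding sum_subtractf[symmetric] by (intro sum.cong) (auto simp: w_def algebra_simps)
    also have "\<dots> = exp (- \<i> * of_real t * quc_eigenvalue n j) * additive_char n (j * int a)
        - \<alpha> * additive_char n (j * int a) - \<beta> * additive_char n (j * int a + j * (int b - int a))"
      using assms by (simp add: transition_matrix_quc_row_eigenvector algebra_simps)
    finally show ?thesis
      unfolding additive_char_add by (simp add: algebra_simps)
  qed
  have "?H *\<^sub>v unit_vec n a = ?w \<longleftrightarrow> (\<forall>x<n. w x = 0)"
  proof -
    have col: "?H *\<^sub>v unit_vec n a = col ?H a"
      using H \<open>a < n\<close> by (intro eq_vecI) auto
    have "vec_index (col ?H a) x - vec_index ?w x = w x" if "x < n" for x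
      using H assms that by (simp add: w_def)
    then have entry: "vec_index (col ?H a) x = vec_index ?w x \<longleftrightarrow> w x = 0" if "x < n" for x
      using that by (metis eq_iff_diff_eq_0)
    have "col ?H a = ?w \<longleftrightarrow> (\<forall>x<n. vec_index (col ?H a) x = vec_index ?w x)"
      using H by (simp add: Matrix.vec_eq_iff)
    then show ?thesis
      unfolding col using entry by blast
  qed
  also have "\<dots> \<longleftrightarrow> ?R"
  proof
    assume "\<forall>x<n. w x = 0"
    then show ?R using col by simp
  next
    assume ?R
    then have "(\<Sum>x<n. additive_char n (j * int x) * w x) = 0" for j
      using col by simp
    then show "\<forall>x<n. w x = 0"
      using character_sums_eq_0_imp_eq_0[of n w] by blast
  qed
  finally show ?thesis .
qed

section \<open>Fractional revival in terms of the spectrum\<close>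

text \<open>The spectral condition for revival between two vertices that differ by
  \<open>n / 2\<close>, where the character values are the signs \<open>(-1)^j\<close>.\<close>

definition parity_phase :: "nat \<Rightarrow> real \<Rightarrow> complex \<Rightarrow> complex \<Rightarrow> bool" where
  "parity_phase n t \<alpha> \<beta> \<longleftrightarrow>
    (\<forall>j. exp (- \<i> * of_real t * quc_eigenvalue n j) = \<alpha> + (if even j then \<beta> else - \<beta>))"

lemma additive_char_half:
  assumes h: "n = 2 * h" "h > 0"
  shows "additive_char n (j * int h) = (if even j then 1 else - 1)"
proof -
  have "n > 0" using h by simp
  show ?thesis
  proof (cases "even j")
    case True
    then have "int n dvd j * int h" using h by auto
    then show ?thesis using True \<open>n > 0\<close> by (simp add: additive_char_eq_1_iff)
  next
    case False
    then obtain k where k: "j = 2 * k + 1" by (elim oddE)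
    then have eq: "j * int h = int h + int n * k" using h by (simp add: algebra_simps)
    have "2 * pi * real h / real n = pi"
      using h by simp
    then have "additive_char n (int h) = - 1"
      by (simp add: additive_char_def)
    then show ?thesis using False
      unfolding eq by (simp add: additive_char_add_multiple[OF \<open>n > 0\<close>])
  qed
qed

text \<open>Let \<open>c = b - a\<close>. Since \<open>j\<close> and \<open>-j\<close> have the same
  eigenvalue, the character at \<open>c\<close> equals its inverse and is thus a sign. Hence
  \<open>n\<close> divides \<open>2 * c\<close> but not \<open>c\<close>, which forces
  \<open>n\<close> to be even and the character at \<open>j * c\<close> to be
  \<open>(-1)^j\<close>.\<close>

lemma admits_fractional_revival_quc_iff:
  assumes "n \<ge> 2"
  shows "admits_fractional_revival (quadratic_unitary_Cayley_graph n) \<longleftrightarrow>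
    even n \<and> (\<exists>t>0. \<exists>\<alpha> \<beta>. \<beta> \<noteq> 0 \<and> (cmod \<alpha>)\<^sup>2 + (cmod \<beta>)\<^sup>2 = 1 \<and> parity_phase n t \<alpha> \<beta>)"
proof -
  have "n > 0" using assms by simp
  have verts: "pverts (quadratic_unitary_Cayley_graph n) = {0..<n}"
    by (simp add: quadratic_unitary_Cayley_graph_def)
  have adm: "admits_fractional_revival (quadratic_unitary_Cayley_graph n) \<longleftrightarrow>
    (\<exists>a b. a < n \<and> b < n \<and> b \<noteq> a \<and> (\<exists>t>0. \<exists>\<alpha> \<beta>. \<beta> \<noteq> 0 \<and> (cmod \<alpha>)\<^sup>2 + (cmod \<beta>)\<^sup>2 = 1 \<and>
      (\<forall>j. exp (- \<i> * of_real t * quc_eigenvalue n j)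
        = \<alpha> + \<beta> * additive_char n (j * (int b - int a)))))"
    unfolding admits_fractional_revival_def fractional_revival_def verts Let_def
    using transition_matrix_quc_column_iff[OF assms] by (simp cong: conj_cong)
  show ?thesis
  proof
    assume "admits_fractional_revival (quadratic_unitary_Cayley_graph n)"
    then obtain a b t \<alpha> \<beta> where ab: "a < n" "b < n" "b \<noteq> a" and t: "t > 0" "\<beta> \<noteq> 0"
        "(cmod \<alpha>)\<^sup>2 + (cmod \<beta>)\<^sup>2 = 1"
      and ph: "\<And>j. exp (- \<i> * of_real t * quc_eigenvalue n j)
        = \<alpha> + \<beta> * additive_char n (j * (int b - int a))"
      unfolding adm by blast
    define c where "c = int b - int a"
    have c: "\<not> int n dvd c"
    proof
      assume "int n dvd c"
      then have "[int b = int a] (mod int n)" by (simp add: c_def cong_iff_dvd_diff)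
      then show False using ab by (simp add: cong_def)
    qed
    have "\<alpha> + \<beta> * additive_char n c = \<alpha> + \<beta> * additive_char n (- c)"
      using ph[of 1] ph[of "- 1"] quc_eigenvalue_uminus[OF \<open>n > 0\<close>, of 1] by (simp add: c_def)
    then have "additive_char n c = additive_char n (- c)" using \<open>\<beta> \<noteq> 0\<close> by simp
    then have sq: "additive_char n c * additive_char n c = 1"
      using additive_char_add[of n c "- c"] by simp
    then have "int n dvd 2 * c"
      using \<open>n > 0\<close> by (simp add: additive_char_add[symmetric] additive_char_eq_1_iff)
    \<comment> \<open>An odd \<open>n\<close> would be coprime to 2 and hence divide
      \<open>c\<close>.\<close>
    then have "even n"
      using c by (metis coprime_dvd_mult_right_iff coprime_right_2_iff_odd even_of_nat_iff)
    have "additive_char n c \<noteq> 1"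
      using c \<open>n > 0\<close> by (simp add: additive_char_eq_1_iff)
    then have m1: "additive_char n c = - 1"
      using sq by (simp add: square_eq_1_iff)
    have "additive_char n (j * c) = (if even j then 1 else - 1)" for j
    proof (cases "even j")
      case True
      then obtain k where "j = 2 * k" by blast
      then have "j * c = k * (2 * c)" by simp
      then have "int n dvd j * c" using \<open>int n dvd 2 * c\<close> by (metis dvd_mult)
      then show ?thesis using True \<open>n > 0\<close> by (simp add: additive_char_eq_1_iff)
    next
      case False
      then obtain k where k: "j = 2 * k + 1" by (elim oddE)
      then have eq: "j * c = 2 * c * k + c" by (simp add: algebra_simps)
      have "int n dvd 2 * c * k" using \<open>int n dvd 2 * c\<close> by (rule dvd_mult2)
      then show ?thesis using False \<open>n > 0\<close> m1
        unfolding eq by (simp add: additive_char_add additive_char_eq_1_iff)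
    qed
    then have "parity_phase n t \<alpha> \<beta>"
      unfolding parity_phase_def using ph by (simp add: c_def)
    then show "even n \<and> (\<exists>t>0. \<exists>\<alpha> \<beta>. \<beta> \<noteq> 0 \<and> (cmod \<alpha>)\<^sup>2 + (cmod \<beta>)\<^sup>2 = 1 \<and> parity_phase n t \<alpha> \<beta>)"
      using \<open>even n\<close> t by blast
  next
    assume "even n \<and> (\<exists>t>0. \<exists>\<alpha> \<beta>. \<beta> \<noteq> 0 \<and> (cmod \<alpha>)\<^sup>2 + (cmod \<beta>)\<^sup>2 = 1 \<and> parity_phase n t \<alpha> \<beta>)"
    then obtain t \<alpha> \<beta> where "even n" and t: "t > 0" "\<beta> \<noteq> 0" "(cmod \<alpha>)\<^sup>2 + (cmod \<beta>)\<^sup>2 = 1"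
      and ph: "parity_phase n t \<alpha> \<beta>"
      by blast
    obtain h where h: "n = 2 * h" using \<open>even n\<close> by blast
    then have "h > 0" using \<open>n > 0\<close> by simp
    have "additive_char n (j * int h) = (if even j then 1 else - 1)" for j
      by (rule additive_char_half[OF h \<open>h > 0\<close>])
    \<comment> \<open>Revival takes place from vertex 0 to vertex \<open>h\<close>, half of
      \<open>n\<close>.\<close>
    then show "admits_fractional_revival (quadratic_unitary_Cayley_graph n)"
      unfolding adm using t ph h \<open>h > 0\<close> unfolding parity_phase_def
      by (intro exI[of _ 0] exI[of _ h] conjI exI[of _ t] exI[of _ \<alpha>] exI[of _ \<beta>]) auto
  qed
qed

section \<open>Integrality of the spectrum\<close>

text \<open>By orthogonality modulo \<open>h\<close>, summing over one parity class keeps only the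
  elements \<open>x\<close> of the connection set divisible by \<open>h\<close>. There are none:
  \<open>x\<close> is coprime to \<open>n\<close>, and \<open>h > 1\<close> divides
  \<open>n\<close>.\<close>

lemma sum_quc_eigenvalue_parity_class:
  assumes "n > 2" "n = 2 * h"
  shows "(\<Sum>i<h. quc_eigenvalue n (2 * int i + r)) = 0"
proof -
  have "h > 1" "n > 0" using assms by auto
  have char: "additive_char n ((2 * int i + r) * x) = additive_char n (r * x) * additive_char h (int i * x)" for i x
  proof -
    have "additive_char n (2 * int i * x) = additive_char h (int i * x)"
      using assms by (simp add: additive_char_def mult_ac)
    then have "additive_char n (r * x + 2 * int i * x) = additive_char n (r * x) * additive_char h (int i * x)"
      by (simp only: additive_char_add)
    then show ?thesis by (simp add: ring_distribs add.commute)
  qed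
  have "(\<Sum>i<h. quc_eigenvalue n (2 * int i + r))
     = (\<Sum>x<n. \<Sum>i<h. if pm_unit_square n (int x) then additive_char n ((2 * int i + r) * int x) else 0)"
    unfolding quc_eigenvalue_def by (rule sum.swap)
  also have "\<dots> = (\<Sum>x<n. if pm_unit_square n (int x)
      then additive_char n (r * int x) * (\<Sum>i<h. additive_char h (int i * int x)) else 0)"
    by (intro sum.cong) (auto simp: char sum_distrib_left)
  also have "\<dots> = 0"
  proof (intro sum.neutral ballI)
    fix x
    have "\<not> int h dvd int x" if "pm_unit_square n (int x)"
    proof
      assume "int h dvd int x"
      moreover have "int h dvd int n" using assms by simp
      ultimately have "is_unit (int h)"
        using pm_unit_square_imp_coprime[OF that] coprime_common_divisor by blast
      then show False using \<open>h > 1\<close> by simp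
    qed
    then show "(if pm_unit_square n (int x)
      then additive_char n (r * int x) * (\<Sum>i<h. additive_char h (int i * int x)) else 0) = 0"
      using sum_additive_char[of h "int x"] \<open>h > 1\<close> by simp
  qed
  finally show ?thesis .
qed

text \<open>
  The eigenvalues of one parity differ by multiples of \<open>2\<pi>/t\<close> and sum to zero. Summing the
  differences to the nonzero integer eigenvalue 0 shows that \<open>2\<pi>/t\<close> is rational.
\<close>

lemma quc_eigenvalue_rational:
  assumes n: "n > 2" "n = 2 * h" and "t > 0" and ph: "parity_phase n t \<alpha> \<beta>"
  shows "quc_eigenvalue n r \<in> \<rat>"
proof -
  define \<delta> where "\<delta> = complex_of_real (2 * pi / t)"
  have h: "of_nat h \<noteq> (0::complex)" using n by simp
  have diff: "\<exists>z::int. quc_eigenvalue n k - quc_eigenvalue n j = \<delta> * of_int z"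
    if "even (j - k)" for j k
  proof -
    have "even j \<longleftrightarrow> even k" using that by simp
    then have "exp (- \<i> * of_real t * quc_eigenvalue n j) = exp (- \<i> * of_real t * quc_eigenvalue n k)"
      using ph unfolding parity_phase_def by simp
    then obtain z :: int where "- \<i> * of_real t * quc_eigenvalue n j
        = - \<i> * of_real t * quc_eigenvalue n k + (of_int (2 * z) * pi) * \<i>"
      unfolding exp_eq by blast
    then have "\<i> * (of_real t * (quc_eigenvalue n k - quc_eigenvalue n j)) = \<i> * (2 * pi * of_int z)"
      by (simp add: algebra_simps)
    then have "of_real t * (quc_eigenvalue n k - quc_eigenvalue n j) = 2 * pi * of_int z"
      by simp
    then have "quc_eigenvalue n k - quc_eigenvalue n j = \<delta> * of_int z"
      using \<open>t > 0\<close> by (simp add: \<delta>_def field_simps)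
    then show ?thesis ..
  qed
  have sum_diff: "\<exists>z::int. of_nat h * quc_eigenvalue n k = \<delta> * of_int z" for k
  proof -
    have "\<forall>i. \<exists>z::int. quc_eigenvalue n k - quc_eigenvalue n (2 * int i + k) = \<delta> * of_int z"
      using diff by simp
    then obtain z :: "nat \<Rightarrow> int"
      where z: "\<And>i. quc_eigenvalue n k - quc_eigenvalue n (2 * int i + k) = \<delta> * of_int (z i)"
      by metis
    \<comment> \<open>The subtracted eigenvalues run through a full parity class and cancel.\<close>
    have "of_nat h * quc_eigenvalue n k = (\<Sum>i<h. quc_eigenvalue n k - quc_eigenvalue n (2 * int i + k))"
      using sum_quc_eigenvalue_parity_class[OF n] by (simp add: sum_subtractf)
    also have "\<dots> = \<delta> * of_int (\<Sum>i<h. z i)"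
      by (simp add: z sum_distrib_left)
    finally show ?thesis ..
  qed
  obtain m where m: "m > 0" "quc_eigenvalue n 0 = of_nat m"
    using quc_eigenvalue_0_nonzero[of n] n by auto
  obtain z where z: "of_nat h * quc_eigenvalue n 0 = \<delta> * of_int z"
    using sum_diff by blast
  then have "\<delta> * of_int z \<noteq> 0" using h m by auto
  then have "z \<noteq> 0" by auto
  then have "\<delta> = of_nat h * of_nat m / of_int z"
    using z m by (simp add: field_simps)
  then have "\<delta> \<in> \<rat>" by simp
  obtain y where "of_nat h * quc_eigenvalue n r = \<delta> * of_int y"
    using sum_diff by blast
  then have "quc_eigenvalue n r = \<delta> * of_int y / of_nat h"
    using h by (simp add: field_simps)
  then show ?thesis using \<open>\<delta> \<in> \<rat>\<close> by simp
qed

text \<open>The matrix is the cyclic shift by \<open>j\<close>. The vector does not depend on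
  \<open>j\<close>, so all \<open>n\<close>-th roots of unity lie in the same ring.\<close>

lemma int_eigenvalue_additive_char:
  assumes "n > 0"
  shows "int_eigenvalue n (Matrix.vec n (\<lambda>k. additive_char n (int k))) (additive_char n j)"
    (is "int_eigenvalue n ?v _")
proof -
  define M :: "int mat" where "M = Matrix.mat n n (\<lambda>(a, b). if int b = (int a + j) mod int n then 1 else 0)"
  have "map_mat complex_of_int M *\<^sub>v ?v = additive_char n j \<cdot>\<^sub>v ?v"
  proof (rule eq_vecI)
    fix a assume "a < dim_vec (additive_char n j \<cdot>\<^sub>v ?v)"
    then have a: "a < n" by simp
    define c where "c = nat ((int a + j) mod int n)"
    have c: "int c = (int a + j) mod int n" using assms by (simp add: c_def)
    then have "c < n" using assms by (metis of_nat_0_less_iff of_nat_less_iff pos_mod_bound)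
    have "vec_index (map_mat complex_of_int M *\<^sub>v ?v) a
        = (\<Sum>b<n. (if b = c then 1 else 0) * additive_char n (int b))"
      using a by (simp add: M_def scalar_prod_def atLeast0LessThan c[symmetric] if_distrib cong: if_cong)
    also have "\<dots> = additive_char n (int c)"
      using \<open>c < n\<close> by (simp add: if_distrib[of "\<lambda>x. x * _"] cong: if_cong)
    also have "\<dots> = additive_char n (int a + j)"
    proof -
      have "[int c = int a + j] (mod int n)" unfolding c by (simp add: cong_def)
      then have "additive_char n (1 * int c) = additive_char n (1 * (int a + j))"
        using periodic_int_additive_char[OF assms] unfolding periodic_int_def by blast
      then show ?thesis by simp
    qed
    finally show "vec_index (map_mat complex_of_int M *\<^sub>v ?v) a = vec_index (additive_char n j \<cdot>\<^sub>v ?v) a"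
      using a by (simp add: additive_char_add mult.commute)
  qed (simp add: M_def)
  then show ?thesis
    unfolding int_eigenvalue_def by (intro bexI[of _ M]) (auto simp: M_def)
qed

section \<open>Invariance of an integral spectrum under units\<close>

lemma fermat_theorem_int:
  fixes a :: int
  assumes p: "prime p" and a: "\<not> int p dvd a"
  shows "[a ^ (p - 1) = 1] (mod int p)"
proof -
  define b where "b = nat (a mod int p)"
  have "p > 0" using p by (simp add: prime_gt_0_nat)
  then have b: "int b = a mod int p" by (simp add: b_def)
  have ab: "[a = int b] (mod int p)" unfolding b by (simp add: cong_def)
  have "\<not> p dvd b" using a ab by (metis cong_dvd_iff int_dvd_int_iff cong_sym)
  then have "[int (b ^ (p - 1)) = int 1] (mod int p)"
    using fermat_theorem[OF p] by (simp only: cong_int_iff)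
  then show ?thesis using cong_pow[OF ab, of "p - 1"] by (auto intro: cong_trans)
qed

context
  fixes n :: nat
  assumes n: "n > 0"
    and rational: "\<And>j. quc_eigenvalue n j \<in> \<rat>"
begin

abbreviation (input) char_vec :: "complex Matrix.vec" where
  "char_vec \<equiv> Matrix.vec n (\<lambda>k. additive_char n (int k))"

lemma char_vec: "char_vec \<in> carrier_vec n" "char_vec \<noteq> 0\<^sub>v n"
proof -
  show "char_vec \<noteq> 0\<^sub>v n"
  proof
    assume "char_vec = 0\<^sub>v n"
    then have "vec_index char_vec 0 = vec_index (0\<^sub>v n) 0" by simp
    then show False using n by simp
  qed
qed simp

text \<open>A sum of roots of unity lies in the ring attached to \<open>char_vec\<close>, and its
  rational members are integers.\<close>

lemma quc_eigenvalue_Ints: "quc_eigenvalue n j \<in> \<int>"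
proof (rule rational_int_eigenvalue_is_int[OF char_vec])
  have "int_eigenvalue n char_vec 0"
    using int_eigenvalue_of_int[OF char_vec(1), of 0] by simp
  then show "int_eigenvalue n char_vec (quc_eigenvalue n j)"
    unfolding quc_eigenvalue_def
    by (intro int_eigenvalue_sum[OF char_vec(1)]) (auto intro: int_eigenvalue_additive_char[OF n])
qed (rule rational)

text \<open>
  \<open>\<lambda>\<^sub>j\<^sub>p \<equiv> \<lambda>\<^sub>j\<^sup>p \<equiv> \<lambda>\<^sub>j\<close> modulo \<open>p\<close>, and both sides are smaller than \<open>p/2\<close>.
\<close>

lemma quc_eigenvalue_mult_large_prime:
  assumes p: "prime p" "p > 2 * n"
  shows "quc_eigenvalue n (int p * j) = quc_eigenvalue n j"
proof -
  let ?S = "{x\<in>{..<n}. pm_unit_square n (int x)}"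
  have ev: "quc_eigenvalue n k = (\<Sum>x\<in>?S. additive_char n (k * int x))" for k
    unfolding quc_eigenvalue_def by (rule sum.inter_filter[symmetric]) simp
  obtain r where r: "int_eigenvalue n char_vec r"
      "quc_eigenvalue n j ^ p = quc_eigenvalue n (int p * j) + of_nat p * r"
    using int_eigenvalue_frobenius[OF char_vec(1) p(1), of ?S "\<lambda>x. additive_char n (j * int x)"]
      int_eigenvalue_additive_char[OF n]
    unfolding ev by (auto simp: additive_char_power mult.assoc)
  obtain a b where a: "quc_eigenvalue n j = of_int a" and b: "quc_eigenvalue n (int p * j) = of_int b"
    using quc_eigenvalue_Ints unfolding Ints_def by blast
  \<comment> \<open>The quotient is rational and in the ring, hence an integer: the Frobenius
    congruence holds among ordinary integers.\<close>
  have "r = (quc_eigenvalue n j ^ p - quc_eigenvalue n (int p * j)) / of_nat p"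
    using r(2) p by simp
  then have "r \<in> \<rat>" using rational by simp
  then have "r \<in> \<int>"
    by (rule rational_int_eigenvalue_is_int[OF char_vec r(1)])
  then obtain c where "r = of_int c" by (elim Ints_cases)
  then have "(of_int (a ^ p) :: complex) = of_int (b + int p * c)"
    using r(2) a b by simp
  then have "a ^ p = b + int p * c" by (simp only: of_int_eq_iff)
  moreover have "[a ^ p = a] (mod int p)"
  proof (cases "int p dvd a")
    case True
    moreover have "a dvd a ^ p" using p(1) by (simp add: dvd_power prime_gt_0_nat)
    ultimately have "int p dvd a ^ p" using dvd_trans by blast
    then show ?thesis using True by (simp add: cong_iff_dvd_diff)
  next
    case False
    have "[a * a ^ (p - 1) = a * 1] (mod int p)"
      using fermat_theorem_int[OF p(1) False] by (intro cong_mult) simp_all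
    moreover have "a * a ^ (p - 1) = a ^ p"
      by (subst mult.commute) (rule power_minus_mult[OF prime_gt_0_nat[OF p(1)]])
    ultimately show ?thesis by simp
  qed
  ultimately have "int p * c - (a ^ p - a) = a - b" "int p dvd a ^ p - a"
    by (simp_all add: cong_iff_dvd_diff)
  then have "int p dvd a - b"
    by (metis dvd_diff dvd_triv_left)
  moreover have "\<bar>a - b\<bar> < int p"
  proof -
    have "real_of_int \<bar>a\<bar> \<le> real n" "real_of_int \<bar>b\<bar> \<le> real n"
      using norm_quc_eigenvalue_le[of n j] norm_quc_eigenvalue_le[of n "int p * j"] a b by simp_all
    then have "\<bar>a\<bar> \<le> int n" "\<bar>b\<bar> \<le> int n" by linarith+
    then show ?thesis using p(2) by linarith
  qed
  ultimately have "a - b = 0"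
    using dvd_imp_le_int[of "a - b" "int p"] by linarith
  then show ?thesis using a b by simp
qed

lemma quc_eigenvalue_mult_large_prime_factors:
  assumes "m > 0" "\<And>p. prime p \<Longrightarrow> p dvd m \<Longrightarrow> p > 2 * n"
  shows "quc_eigenvalue n (int m * j) = quc_eigenvalue n j"
  using assms
proof (induction m arbitrary: j rule: prime_divisors_induct)
  case (factor p m)
  then have "quc_eigenvalue n (int m * j) = quc_eigenvalue n j" by simp
  moreover have "quc_eigenvalue n (int p * (int m * j)) = quc_eigenvalue n (int m * j)"
    using factor by (intro quc_eigenvalue_mult_large_prime) auto
  ultimately show ?case by (simp add: mult.assoc)
qed auto

text \<open>The unit \<open>a\<close> is replaced by a positive integer \<open>m\<close> congruent
  to it modulo \<open>n\<close> and coprime to the factorial of \<open>2 * n\<close>. All prime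
  factors of \<open>m\<close> exceed \<open>2 * n\<close>, so no theorem on primes in progressions
  is called upon.\<close>

lemma quc_eigenvalue_mult_unit:
  assumes "coprime a (int n)"
  shows "quc_eigenvalue n (a * j) = quc_eigenvalue n j"
proof -
  define N where "N = int n * fact (2 * n)"
  have "N > 0" using n by (simp add: N_def)
  obtain b where b: "[b = a] (mod int n)" "coprime b N"
    using coprime_lift[OF assms \<open>N > 0\<close>] .
  define m where "m = nat (b mod N)"
  have m: "int m = b mod N" using \<open>N > 0\<close> by (simp add: m_def)
  have cop: "coprime (int m) N" using b(2) \<open>N > 0\<close> unfolding m by simp
  have "[int m = b] (mod N)" unfolding m by (simp add: cong_def)
  then have "[int m = b] (mod int n)"
    unfolding N_def by (rule cong_modulus_mult)
  then have "[int m * j = a * j] (mod int n)"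
    using b(1) by (intro cong_mult) (auto intro: cong_trans)
  then have "quc_eigenvalue n (a * j) = quc_eigenvalue n (int m * j)"
    using quc_eigenvalue_cong[OF n] by metis
  also have "\<dots> = quc_eigenvalue n j"
  proof (rule quc_eigenvalue_mult_large_prime_factors)
    \<comment> \<open>This excludes \<open>m = 0\<close>, which would be coprime to \<open>N\<close>
      only for \<open>N = 1\<close>.\<close>
    have "N \<noteq> 1"
    proof
      assume "N = 1"
      have "int 2 dvd int (fact (2 * n))"
        unfolding int_dvd_int_iff using n by (intro dvd_fact) auto
      then have "2 dvd (fact (2 * n) :: int)" by (simp only: of_nat_fact of_nat_numeral)
      then have "2 dvd N" unfolding N_def by (rule dvd_mult)
      with \<open>N = 1\<close> show False by simp
    qed
    then show "m > 0" using cop \<open>N > 0\<close> by (cases "m = 0") auto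
    fix p assume p: "prime p" "p dvd m"
    show "p > 2 * n"
    proof (rule ccontr)
      assume "\<not> p > 2 * n"
      then have "p dvd fact (2 * n)" using p(1) by (simp add: prime_dvd_fact_iff)
      then have "int p dvd N" unfolding N_def
        by (metis dvd_mult int_dvd_int_iff of_nat_fact)
      moreover have "int p dvd int m" using p(2) by simp
      ultimately have "is_unit (int p)" using cop coprime_common_divisor by blast
      then show False using p(1) by simp
    qed
  qed
  finally show ?thesis .
qed

text \<open>Fourier inversion carries the invariance of the spectrum over to the connection set,
  which contains 1 and therefore every unit.\<close>

lemma pm_unit_square_if_coprime:
  assumes a: "coprime a (int n)"
  shows "pm_unit_square n a"
proof -
  \<comment> \<open>The inverse transform of the spectrum: \<open>n\<close> times the indicator of
    the connection set.\<close>
  define F where "F x = (\<Sum>j<n. quc_eigenvalue n (int j) * additive_char n (- x * int j))" for x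
  have per: "periodic_int n (\<lambda>j. quc_eigenvalue n j * additive_char n (- x * j))" for x
    using periodic_int_additive_char[OF n, of "- x"] quc_eigenvalue_cong[OF n]
    unfolding periodic_int_def by metis
  have inv: "F x = of_nat n * (if pm_unit_square n x then 1 else 0)" for x
  proof -
    define c where "c = nat (x mod int n)"
    have c: "int c = x mod int n" using n by (simp add: c_def)
    then have "c < n" using n by (metis of_nat_0_less_iff of_nat_less_iff pos_mod_bound)
    have dvd: "int n dvd int y - x \<longleftrightarrow> y = c" if "y < n" for y
      using that c n by (metis cong_iff_dvd_diff cong_def mod_less zmod_int of_nat_eq_iff mod_mod_trivial)
    have "F x = (\<Sum>j<n. \<Sum>y<n. if pm_unit_square n (int y) then additive_char n (int j * (int y - x)) else 0)"
      unfolding F_def quc_eigenvalue_def sum_distrib_right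
      by (intro sum.cong) (auto simp: additive_char_add[symmetric] algebra_simps)
    also have "\<dots> = (\<Sum>y<n. if pm_unit_square n (int y) then (\<Sum>j<n. additive_char n (int j * (int y - x))) else 0)"
      by (subst sum.swap) (intro sum.cong, auto)
    also have "\<dots> = (\<Sum>y<n. if y = c then (if pm_unit_square n (int y) then of_nat n else 0) else 0)"
      by (intro sum.cong) (auto simp: sum_additive_char[OF n] dvd)
    also have "\<dots> = (if pm_unit_square n (int c) then of_nat n else 0)"
      using \<open>c < n\<close> by simp
    also have "pm_unit_square n (int c) = pm_unit_square n x"
      by (rule pm_unit_square_cong) (simp add: c cong_def)
    finally show ?thesis by simp
  qed
  \<comment> \<open>Replace the eigenvalue at \<open>j\<close> by the one at \<open>a * j\<close>;
    substituting \<open>a * j\<close> as the new summation index then gives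
    \<open>F 1\<close>.\<close>
  have "F a = (\<Sum>j<n. quc_eigenvalue n (a * int j + 0) * additive_char n (- 1 * (a * int j + 0)))"
    unfolding F_def using quc_eigenvalue_mult_unit[OF a] by simp
  also have "\<dots> = F 1"
    unfolding F_def by (rule sum_periodic_affine[OF n per a])
  finally show ?thesis
    using inv n pm_unit_square_1[of n] by (auto split: if_splits)
qed

end

section \<open>Moduli all of whose units are squares up to sign\<close>

definition all_units_pm_square :: "nat \<Rightarrow> bool" where
  "all_units_pm_square n \<longleftrightarrow> (\<forall>a. coprime a (int n) \<longrightarrow> pm_unit_square n a)"

text \<open>Units modulo \<open>d\<close> lift to units modulo \<open>n\<close>. Obstructions thus
  need to be found only for small divisors of \<open>n\<close>.\<close>

lemma all_units_pm_square_dvd: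
  assumes n: "all_units_pm_square n" "n > 0" and d: "d dvd n"
  shows "all_units_pm_square d"
  unfolding all_units_pm_square_def
proof (intro allI impI)
  fix a assume "coprime a (int d)"
  then obtain b where b: "[b = a] (mod int d)" "coprime b (int n)"
    using coprime_lift[of a "int d" "int n"] \<open>n > 0\<close> by auto
  have "int d dvd int n" using d by simp
  obtain u where u: "coprime u (int n)" "[b = u\<^sup>2] (mod int n) \<or> [b = - (u\<^sup>2)] (mod int n)"
    using n(1) b(2) unfolding all_units_pm_square_def pm_unit_square_def by blast
  have "coprime u (int d)"
    using u(1) \<open>int d dvd int n\<close> by (rule coprime_divisors[OF dvd_refl, rotated])
  moreover have "[b = u\<^sup>2] (mod int d) \<or> [b = - (u\<^sup>2)] (mod int d)"
    using u(2) \<open>int d dvd int n\<close> cong_dvd_modulus by blast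
  ultimately have "pm_unit_square d b" unfolding pm_unit_square_def by blast
  then show "pm_unit_square d a" using pm_unit_square_cong[OF b(1)] by simp
qed

text \<open>Squares modulo 8 are 0, 1 and 4, so neither 3 nor -3 is a square.\<close>

lemma not_all_units_pm_square_8: "\<not> all_units_pm_square 8"
proof
  assume "all_units_pm_square 8"
  moreover have "coprime (3::int) (int 8)"
  proof -
    have "coprime (3::int) (2 ^ 3)" by (simp only: coprime_power_right_iff coprime_right_2_iff_odd) simp
    then show ?thesis by simp
  qed
  ultimately obtain u :: int where u: "[3 = u\<^sup>2] (mod 8) \<or> [3 = - (u\<^sup>2)] (mod 8)"
    unfolding all_units_pm_square_def pm_unit_square_def by (metis of_nat_numeral)
  have "u mod 8 \<in> {0..<8}" by simp
  moreover have "{0..<8} = {0, 1, 2, 3, 4, 5, 6, 7::int}" by auto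
  ultimately have "(u mod 8)\<^sup>2 mod 8 \<in> {0, 1, 4}" by auto
  then have "u\<^sup>2 mod 8 \<in> {0, 1, 4}" by (simp add: power_mod)
  then have "\<not> [3 = u\<^sup>2] (mod 8)" "\<not> [- 3 = u\<^sup>2] (mod 8)" by (auto simp: cong_def)
  moreover have "[3 = - (u\<^sup>2)] (mod 8) \<longleftrightarrow> [- 3 = u\<^sup>2] (mod 8)"
    using cong_minus_minus_iff[of "- 3" "u\<^sup>2" 8] by simp
  ultimately show False using u by simp
qed

text \<open>The witness is a unit that is \<open>1\<close> modulo one factor and \<open>-1\<close> modulo the other.\<close>

lemma not_all_units_pm_square_mult:
  assumes "coprime d e"
    and d: "\<And>u. \<not> [u\<^sup>2 = - 1] (mod int d)" and e: "\<And>u. \<not> [u\<^sup>2 = - 1] (mod int e)"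
  shows "\<not> all_units_pm_square (d * e)"
proof
  assume all: "all_units_pm_square (d * e)"
  obtain a where a: "[a = 1] (mod int d)" "[a = - 1] (mod int e)"
    using binary_chinese_remainder_int[of "int d" "int e"] assms(1) by auto
  have "coprime a (int d)" "coprime a (int e)"
    using a by (metis cong_imp_coprime cong_sym coprime_1_left)
      (metis a(2) cong_imp_coprime cong_sym coprime_1_left coprime_minus_left_iff)
  then have "coprime a (int (d * e))" by simp
  then obtain u where "[a = u\<^sup>2] (mod int (d * e)) \<or> [a = - (u\<^sup>2)] (mod int (d * e))"
    using all unfolding all_units_pm_square_def pm_unit_square_def by blast
  \<comment> \<open>The sign + would make -1 a square modulo \<open>e\<close>, the sign - would make
    it a square modulo \<open>d\<close>.\<close>
  then show False
  proof
    assume "[a = u\<^sup>2] (mod int (d * e))"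
    then have "[a = u\<^sup>2] (mod int e)" by (rule cong_dvd_modulus) simp
    then have "[u\<^sup>2 = - 1] (mod int e)" using a(2) by (metis cong_sym cong_trans)
    then show False using e by blast
  next
    assume "[a = - (u\<^sup>2)] (mod int (d * e))"
    then have "[a = - (u\<^sup>2)] (mod int d)" by (rule cong_dvd_modulus) simp
    then have "[- (u\<^sup>2) = 1] (mod int d)" using a(1) by (metis cong_sym cong_trans)
    then have "[u\<^sup>2 = - 1] (mod int d)"
      using cong_minus_minus_iff[of "u\<^sup>2" "- 1" "int d"] by simp
    then show False using d by blast
  qed
qed

lemma square_not_cong_minus_1_mod_4: "\<not> [u\<^sup>2 = - 1] (mod int 4)"
proof -
  have "u mod 4 \<in> {0..<4}" by simp
  moreover have "{0..<4} = {0, 1, 2, 3::int}" by auto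
  ultimately have "(u mod 4)\<^sup>2 mod 4 \<in> {0, 1}" by auto
  then have "u\<^sup>2 mod 4 \<in> {0, 1}" by (simp add: power_mod)
  then show ?thesis by (auto simp: cong_def)
qed

text \<open>Raising the congruence to the odd power \<open>(p - 1) / 2\<close> turns the left side
  into 1 by Fermat and the right side into -1.\<close>

lemma square_not_cong_minus_1_mod_prime:
  assumes p: "prime p" "p mod 4 = 3"
  shows "\<not> [u\<^sup>2 = - 1] (mod int p)"
proof
  assume u: "[u\<^sup>2 = - 1] (mod int p)"
  obtain k where k: "p = 4 * k + 3" using p(2) by (metis mult_div_mod_eq)
  have "\<not> int p dvd u"
  proof
    assume "int p dvd u"
    then have "int p dvd u\<^sup>2" by (simp add: power2_eq_square)
    then have "int p dvd - 1" using cong_dvd_iff[OF u] by simp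
    then show False using p(1) by simp
  qed
  then have "[u ^ (p - 1) = 1] (mod int p)" by (rule fermat_theorem_int[OF p(1)])
  moreover have "[(u\<^sup>2) ^ (2 * k + 1) = (- 1) ^ (2 * k + 1)] (mod int p)"
    by (rule cong_pow[OF u])
  moreover have "(u\<^sup>2) ^ (2 * k + 1) = u ^ (p - 1)"
    by (simp only: power_mult[symmetric]) (simp add: k)
  ultimately have "[- 1 = 1] (mod int p)"
    by (simp add: cong_def)
  then have "int p dvd 2" by (simp add: cong_iff_dvd_diff)
  then show False using zdvd_imp_le[of "int p" 2] k by simp
qed

text \<open>If \<open>p = 4 * k + 1\<close>, the even power \<open>2 * k = (p - 1) / 2\<close> sends
  every unit of the form plus or minus a square to 1. A primitive root has order
  \<open>p - 1\<close> and is not sent to 1.\<close>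

lemma all_units_pm_square_prime_mod_4:
  assumes p: "prime p" "odd p" "all_units_pm_square p"
  shows "p mod 4 = 3"
proof (rule ccontr)
  assume "p mod 4 \<noteq> 3"
  with p(2) have "p mod 4 = 1" by presburger
  then obtain k where k: "p = 4 * k + 1" by (metis mult_div_mod_eq)
  then have "k > 0" using p(1) by (cases k) auto
  obtain g where g: "residue_primroot p g"
    using prime_primitive_root_exists[of p] p(1) prime_gt_1_nat by blast
  then have cop: "coprime (int g) (int p)" and ord: "ord p g = p - 1"
    using p(1) by (auto simp: residue_primroot_def totient_prime coprime_commute)
  obtain u where u: "coprime u (int p)" "[int g = u\<^sup>2] (mod int p) \<or> [int g = - (u\<^sup>2)] (mod int p)"
    using p(3) cop unfolding all_units_pm_square_def pm_unit_square_def by blast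
  then have "[int g ^ (2 * k) = (u\<^sup>2) ^ (2 * k)] (mod int p)"
    by (auto dest: cong_pow[of _ _ _ "2 * k"])
  also have "(u\<^sup>2) ^ (2 * k) = u ^ (p - 1)"
    by (simp only: power_mult[symmetric]) (simp add: k)
  also have "[u ^ (p - 1) = 1] (mod int p)"
  proof (rule fermat_theorem_int[OF p(1)])
    show "\<not> int p dvd u"
      using u(1) p(1) by (metis coprime_common_divisor dvd_refl not_prime_unit prime_nat_int_transfer)
  qed
  finally have "[int (g ^ (2 * k)) = int 1] (mod int p)" by simp
  then have "[g ^ (2 * k) = 1] (mod p)" by (simp only: cong_int_iff)
  then have "p - 1 dvd 2 * k" using ord ord_divides by metis
  then show False using k \<open>k > 0\<close> by (auto dest: dvd_imp_le)
qed

text \<open>By Euler's criterion \<open>s = d ^ ((p - 1) / 2)\<close> is 1 or -1 modulo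
  \<open>p\<close>. As \<open>p = 4 * k + 3\<close>, the product \<open>d * s\<close> has even
  exponent \<open>2 * k + 2\<close>, so it is the square of \<open>w = d ^ (k + 1)\<close>. Modulo 2
  both signs work.\<close>

lemma all_units_pm_square_2p:
  assumes p: "prime p" "p mod 4 = 3"
  shows "all_units_pm_square (2 * p)"
  unfolding all_units_pm_square_def
proof (intro allI impI)
  fix d assume "coprime d (int (2 * p))"
  then have "odd d" and "coprime d (int p)" by simp_all
  obtain k where k: "p = 4 * k + 3" using p(2) by (metis mult_div_mod_eq)
  have odd_p: "odd p" using k by simp
  define w where "w = d ^ (k + 1)"
  define s where "s = d ^ (2 * k + 1)"
  have w: "w\<^sup>2 = d * s" by (simp add: w_def s_def power2_eq_square power_add[symmetric] mult_2)
  have "\<not> int p dvd d"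
    using \<open>coprime d (int p)\<close> p(1)
    by (metis coprime_common_divisor dvd_refl not_prime_unit prime_nat_int_transfer)
  then have "[d ^ (p - 1) = 1] (mod int p)" by (rule fermat_theorem_int[OF p(1)])
  moreover have "d ^ (p - 1) = s * s"
  proof -
    have "p - 1 = (2 * k + 1) + (2 * k + 1)" using k by simp
    then show ?thesis by (simp only: s_def power_add)
  qed
  ultimately have "int p dvd s * s - 1" by (simp add: cong_iff_dvd_diff)
  also have "s * s - 1 = (s - 1) * (s + 1)" by (simp add: algebra_simps)
  finally have "int p dvd s - 1 \<or> int p dvd s + 1"
    using p(1) by (simp add: prime_dvd_mult_iff)
  then have "[s = 1] (mod int p) \<or> [s = - 1] (mod int p)" by (simp add: cong_iff_dvd_diff)
  then have "[d * s = d * 1] (mod int p) \<or> [d * s = d * - 1] (mod int p)"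
    using cong_mult[OF cong_refl[of d]] by blast
  then have dw: "int p dvd d - w\<^sup>2 \<or> int p dvd d + w\<^sup>2"
    unfolding w by (auto simp: cong_iff_dvd_diff dvd_diff_commute add.commute)
  have "odd w" using \<open>odd d\<close> by (simp add: w_def)
  then have ev: "2 dvd d - w\<^sup>2" "2 dvd d + w\<^sup>2" using \<open>odd d\<close> by simp_all
  have "coprime (2::int) (int p)" using odd_p by simp
  then have "2 * int p dvd d - w\<^sup>2 \<or> 2 * int p dvd d + w\<^sup>2"
    using dw ev divides_mult by blast
  then have "[d = w\<^sup>2] (mod int (2 * p)) \<or> [d = - (w\<^sup>2)] (mod int (2 * p))"
    by (simp add: cong_iff_dvd_diff)
  moreover have "coprime w (int (2 * p))"
    using \<open>coprime d (int (2 * p))\<close> by (simp add: w_def)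
  ultimately show "pm_unit_square (2 * p) d" unfolding pm_unit_square_def by blast
qed

text \<open>The divisors 8, \<open>p * q\<close> and \<open>4 * p\<close>, with \<open>p\<close> and
  \<open>q\<close> distinct odd primes, are impossible; for the last two, -1 is a nonsquare modulo
  each of the coprime factors. The hypothesis \<open>sqfree\<close> removes twice a higher prime
  power and is later obtained from the phases.\<close>

lemma all_units_pm_square_classification:
  assumes n: "even n" "n > 2" and all: "all_units_pm_square n"
    and sqfree: "\<And>p. prime p \<Longrightarrow> odd p \<Longrightarrow> \<not> p * p dvd n"
  shows "n = 4 \<or> (\<exists>p. prime p \<and> p mod 4 = 3 \<and> n = 2 * p)"
proof -
  have "n > 0" using n by simp
  note dvd = all_units_pm_square_dvd[OF all \<open>n > 0\<close>]
  have mod4: "p mod 4 = 3" if "prime p" "odd p" "p dvd n" for p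
    using all_units_pm_square_prime_mod_4 dvd that by blast
  have no8: "\<not> 8 dvd n" using dvd not_all_units_pm_square_8 by blast
  have no_pq: False if "prime p" "odd p" "p dvd n" "prime q" "odd q" "q dvd n" "p \<noteq> q" for p q
  proof -
    have "coprime p q" using that by (simp add: primes_coprime)
    then have "p * q dvd n" using that by (simp add: divides_mult)
    moreover have "\<not> all_units_pm_square (p * q)"
      using \<open>coprime p q\<close> that by (intro not_all_units_pm_square_mult square_not_cong_minus_1_mod_prime mod4)
    ultimately show False using dvd by blast
  qed
  have no_4p: False if "4 dvd n" "prime p" "odd p" "p dvd n" for p
  proof -
    have "coprime (2 ^ 2) p"
      using that by (simp only: coprime_power_left_iff coprime_left_2_iff_odd) simp
    then have "coprime 4 p" by simp
    then have "4 * p dvd n" using that by (simp add: divides_mult)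
    moreover have "\<not> all_units_pm_square (4 * p)"
      using \<open>coprime 4 p\<close> that
      by (intro not_all_units_pm_square_mult square_not_cong_minus_1_mod_prime
          square_not_cong_minus_1_mod_4 mod4)
    ultimately show False using dvd by blast
  qed
  show ?thesis
  proof (cases "4 dvd n")
    case True
    then obtain m where m: "n = 4 * m" by blast
    have "m = 1"
    proof (rule ccontr)
      assume "m \<noteq> 1"
      then obtain q where q: "prime q" "q dvd m" using prime_factor_nat by blast
      show False
      proof (cases "q = 2")
        case True
        then show False using no8 q(2) m by auto
      next
        case False
        then have "odd q" using q(1) primes_dvd_imp_eq two_is_prime_nat by blast
        then show False using no_4p[OF True q(1)] q(2) m by simp
      qed
    qed
    then show ?thesis using m by simp
  next
    case False
    obtain m where m: "n = 2 * m" using n by blast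
    have "odd m" using False m by auto
    have "m \<noteq> 1" using n m by simp
    then obtain p where p: "prime p" "p dvd m" using prime_factor_nat by blast
    then obtain k where k: "m = p * k" by blast
    have "odd p" using \<open>odd m\<close> k by simp
    have "k = 1"
    proof (rule ccontr)
      assume "k \<noteq> 1"
      then obtain q where q: "prime q" "q dvd k" using prime_factor_nat by blast
      then have "odd q" using \<open>odd m\<close> k by auto
      show False
      proof (cases "q = p")
        case True
        then have "p * p dvd n" using q(2) m k by auto
        then show False using sqfree p \<open>odd p\<close> by blast
      next
        case False
        then show False using no_pq[of p q] p q \<open>odd p\<close> \<open>odd q\<close> m k by simp
      qed
    qed
    then show ?thesis using mod4[of p] p \<open>odd p\<close> m k by auto
  qed
qed

text \<open>With \<open>h = n / p\<close> still divisible by \<open>p\<close>, being a unit modulo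
  \<open>n\<close> depends only on the residue modulo \<open>h\<close>. Translation by
  \<open>h\<close> thus preserves the connection set but multiplies the eigenvalue by a character
  value different from 1.\<close>

lemma quc_eigenvalue_eq_0:
  assumes "n > 0" and all: "all_units_pm_square n" and p: "p * p dvd n" "\<not> int p dvd j"
  shows "quc_eigenvalue n j = 0"
proof -
  obtain k where k: "n = p * p * k" using p by blast
  define h where "h = p * k"
  have h: "n = p * h" "p dvd h" using k by (simp_all add: h_def)
  have pm: "pm_unit_square n x \<longleftrightarrow> coprime x (int h)" for x
  proof -
    have "pm_unit_square n x \<longleftrightarrow> coprime x (int n)"
      using all pm_unit_square_imp_coprime unfolding all_units_pm_square_def by blast
    also have "\<dots> \<longleftrightarrow> coprime x (int h)"
      using h coprime_divisors[of x x "int p" "int h"] by auto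
    finally show ?thesis .
  qed
  have shift: "pm_unit_square n (x + int h) \<longleftrightarrow> pm_unit_square n x" for x
    unfolding pm by (simp add: coprime_iff_gcd_eq_1)
  have "quc_eigenvalue n j = (\<Sum>x<n. if pm_unit_square n (1 * int x + int h)
      then additive_char n (j * (1 * int x + int h)) else 0)"
    unfolding quc_eigenvalue_def
    by (rule sum_periodic_affine[OF \<open>n > 0\<close> periodic_int_quc_summand[OF \<open>n > 0\<close>], symmetric]) simp
  also have "\<dots> = (\<Sum>x<n. additive_char n (j * int h) *
      (if pm_unit_square n (int x) then additive_char n (j * int x) else 0))"
    by (intro sum.cong) (auto simp: shift additive_char_add[symmetric] algebra_simps)
  also have "\<dots> = additive_char n (j * int h) * quc_eigenvalue n j"
    unfolding quc_eigenvalue_def sum_distrib_left ..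
  finally have "(additive_char n (j * int h) - 1) * quc_eigenvalue n j = 0"
    by (simp add: algebra_simps)
  moreover have "\<not> int n dvd j * int h"
    using p(2) h \<open>n > 0\<close> by auto
  ultimately show ?thesis
    using \<open>n > 0\<close> by (simp add: additive_char_eq_1_iff)
qed

section \<open>The graphs with fractional revival\<close>

lemma admits_fractional_revival_qucI:
  assumes "parity_phase n t \<alpha> \<beta>" "n \<ge> 2" "even n" "t > 0" "\<beta> \<noteq> 0" "(cmod \<alpha>)\<^sup>2 + (cmod \<beta>)\<^sup>2 = 1"
  shows "admits_fractional_revival (quadratic_unitary_Cayley_graph n)"
  using assms admits_fractional_revival_quc_iff by blast

text \<open>The indicator of odd \<open>x\<close> is \<open>(1 - (-1)^x) / 2\<close>, and the sign
  is the character value at \<open>x * h\<close>; two applications of orthogonality remain.\<close>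

lemma sum_additive_char_odd:
  assumes h: "n = 2 * h" "h > 0"
  shows "(\<Sum>x<n. if odd x then additive_char n (j * int x) else 0)
    = of_nat h * (of_bool (int n dvd j) - of_bool (int n dvd j + int h))"
proof -
  have "n > 0" using h by simp
  have "(if odd x then additive_char n (j * int x) else 0)
      = (additive_char n (int x * j) - additive_char n (int x * (j + int h))) / 2" for x
    using additive_char_half[OF h, of "int x"] by (simp add: additive_char_add ring_distribs mult.commute)
  then have "(\<Sum>x<n. if odd x then additive_char n (j * int x) else 0)
      = ((\<Sum>x<n. additive_char n (int x * j)) - (\<Sum>x<n. additive_char n (int x * (j + int h)))) / 2"
    by (simp only: sum_divide_distrib[symmetric] sum_subtractf)
  also have "\<dots> = of_nat h * (of_bool (int n dvd j) - of_bool (int n dvd j + int h))"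
    unfolding sum_additive_char[OF \<open>n > 0\<close>] using h by simp
  finally show ?thesis .
qed

text \<open>The connection set consists of all odd residues except \<open>p\<close>, whose character
  value is the sign \<open>(-1)^j\<close>.\<close>

lemma quc_eigenvalue_2p:
  assumes p: "prime p" "p mod 4 = 3"
  shows "quc_eigenvalue (2 * p) j = of_nat p * (of_bool (int (2 * p) dvd j) - of_bool (int (2 * p) dvd j + int p))
    - (if even j then 1 else - 1)"
proof -
  have "p > 0" using p(1) by (simp add: prime_gt_0_nat)
  have "odd p" using p(2) by presburger
  have summand: "(if pm_unit_square (2 * p) (int x) then additive_char (2 * p) (j * int x) else 0)
     = (if odd x then additive_char (2 * p) (j * int x) else 0)
       - (if x = p then additive_char (2 * p) (j * int p) else 0)" if "x < 2 * p" for x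
  proof -
    have "pm_unit_square (2 * p) (int x) \<longleftrightarrow> coprime (int x) (int (2 * p))"
      using all_units_pm_square_2p[OF p] pm_unit_square_imp_coprime
      unfolding all_units_pm_square_def by blast
    also have "\<dots> \<longleftrightarrow> coprime x (2 * p)"
      by (rule coprime_int_iff)
    also have "\<dots> \<longleftrightarrow> odd x \<and> coprime x p" by simp
    also have "coprime x p \<longleftrightarrow> \<not> p dvd x"
      using p(1) by (metis coprime_commute prime_imp_coprime coprime_common_divisor dvd_refl not_prime_unit)
    also have "odd x \<and> \<not> p dvd x \<longleftrightarrow> odd x \<and> x \<noteq> p"
    proof -
      have "x = p" if x: "p dvd x" "odd x"
      proof -
        obtain c where c: "x = p * c" using x by blast
        then have "c < 2" using \<open>x < 2 * p\<close> \<open>p > 0\<close> by simp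
        then have "c = 0 \<or> c = 1" by auto
        then show ?thesis using c x by auto
      qed
      then show ?thesis by auto
    qed
    finally show ?thesis using \<open>odd p\<close> by auto
  qed
  have "quc_eigenvalue (2 * p) j = (\<Sum>x<2*p. if odd x then additive_char (2 * p) (j * int x) else 0)
      - additive_char (2 * p) (j * int p)"
    unfolding quc_eigenvalue_def using \<open>p > 0\<close> by (simp add: summand sum_subtractf)
  then show ?thesis
    by (simp add: sum_additive_char_odd[OF refl \<open>p > 0\<close>] additive_char_half[OF refl \<open>p > 0\<close>])
qed

lemma admits_fractional_revival_quc_2p:
  assumes p: "prime p" "p mod 4 = 3"
  shows "admits_fractional_revival (quadratic_unitary_Cayley_graph (2 * p))"
proof -
  have "p \<ge> 3" using p(2) mod_less_eq_dividend[of p 4] by simp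
  \<comment> \<open>At this time the multiples of \<open>p\<close> in the eigenvalues contribute
    full turns. Only the phase \<open>cis \<theta>\<close> for even \<open>j\<close> and its
    conjugate for odd \<open>j\<close> survive, with half-sum \<open>cos \<theta>\<close> and
    half-difference \<open>\<i> * sin \<theta>\<close>.\<close>
  define \<theta> where "\<theta> = 2 * pi / real p"
  have "0 < \<theta>" "\<theta> < pi" using \<open>p \<ge> 3\<close> by (simp_all add: \<theta>_def field_simps)
  then have "sin \<theta> > 0" by (rule sin_gt_zero)
  have p\<theta>: "\<theta> * real p = 2 * pi" using \<open>p \<ge> 3\<close> by (simp add: \<theta>_def)
  have phase: "exp (- \<i> * of_real \<theta> * (of_nat p * of_int m - of_int s)) = cis (of_int s * \<theta>)" for m s :: int
  proof -
    have "- \<i> * of_real \<theta> * (of_nat p * of_int m - of_int s)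
        = \<i> * of_real (of_int s * \<theta>) - \<i> * (of_real (\<theta> * real p) * of_int m)"
      by (simp add: algebra_simps)
    also have "\<dots> = \<i> * of_real (of_int s * \<theta>) + (of_int (2 * (- m)) * pi) * \<i>"
      unfolding p\<theta> by (simp add: algebra_simps)
    finally show ?thesis
      unfolding cis_conv_exp exp_eq by blast
  qed
  have "parity_phase (2 * p) \<theta> (of_real (cos \<theta>)) (\<i> * of_real (sin \<theta>))"
    unfolding parity_phase_def
  proof
    fix j
    let ?m = "of_bool (int (2 * p) dvd j) - of_bool (int (2 * p) dvd j + int p) :: int"
    let ?s = "if even j then 1 else - 1 :: int"
    have "quc_eigenvalue (2 * p) j = of_nat p * of_int ?m - of_int ?s"
      unfolding quc_eigenvalue_2p[OF p] by simp
    then have "exp (- \<i> * of_real \<theta> * quc_eigenvalue (2 * p) j) = cis (of_int ?s * \<theta>)"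
      using phase by metis
    then show "exp (- \<i> * of_real \<theta> * quc_eigenvalue (2 * p) j) = of_real (cos \<theta>)
        + (if even j then \<i> * of_real (sin \<theta>) else - (\<i> * of_real (sin \<theta>)))"
      by (simp add: complex_eq_iff)
  qed
  moreover have "(cmod (of_real (cos \<theta>)))\<^sup>2 + (cmod (\<i> * of_real (sin \<theta>)))\<^sup>2 = 1"
    by (simp add: norm_mult)
  ultimately show ?thesis
    using \<open>p \<ge> 3\<close> \<open>0 < \<theta>\<close> \<open>sin \<theta> > 0\<close>
    by (intro admits_fractional_revival_qucI) auto
qed

section \<open>The cases n = 2 and n = 4\<close>

lemma quc_eigenvalue_odd_units:
  assumes h: "n = 2 * h" "h > 0" and odd: "\<And>x. pm_unit_square n x \<longleftrightarrow> odd x"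
  shows "quc_eigenvalue n j = of_nat h * (of_bool (int n dvd j) - of_bool (int n dvd j + int h))"
  unfolding quc_eigenvalue_def using sum_additive_char_odd[OF h, of j] by (simp add: odd cong: if_cong)

lemma exp_minus_ii_times: "exp (- \<i> * of_real t * of_real x) = cis (- (t * x))"
  by (simp add: cis_conv_exp mult.assoc)

text \<open>The graph is a single edge with eigenvalues 1 and -1. At time \<open>pi / 2\<close> the
  phases are opposite, so \<open>\<alpha> = 0\<close>: the state is transferred completely.\<close>

lemma admits_fractional_revival_quc_2:
  "admits_fractional_revival (quadratic_unitary_Cayley_graph 2)"
proof -
  have "pm_unit_square 2 x \<longleftrightarrow> odd x" for x
  proof
    assume "odd x"
    then have "[x = 1] (mod int 2)" by (simp add: cong_iff_dvd_diff)
    then show "pm_unit_square 2 x" using pm_unit_square_cong pm_unit_square_1 by blast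
  qed (use pm_unit_square_imp_coprime[of 2 x] in simp)
  then have "quc_eigenvalue 2 j = (if even j then 1 else - 1)" for j
    using quc_eigenvalue_odd_units[of 2 1 j] by simp
  moreover have "exp (- \<i> * of_real (pi / 2) * 1) = - \<i>" "exp (- \<i> * of_real (pi / 2) * - 1) = \<i>"
    using exp_minus_ii_times[of "pi / 2" 1] exp_minus_ii_times[of "pi / 2" "- 1"] by simp_all
  ultimately have "parity_phase 2 (pi / 2) 0 (- \<i>)"
    unfolding parity_phase_def by simp
  then show ?thesis
    by (intro admits_fractional_revival_qucI) auto
qed

text \<open>The graph is the 4-cycle, with eigenvalues 2 and -2 at even and 0 at odd
  \<open>j\<close>. At time \<open>pi / 2\<close> the phases are -1 and 1, again with
  \<open>\<alpha> = 0\<close>.\<close>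

lemma admits_fractional_revival_quc_4:
  "admits_fractional_revival (quadratic_unitary_Cayley_graph 4)"
proof -
  have "pm_unit_square 4 x \<longleftrightarrow> odd x" for x
  proof
    assume "odd x"
    then have "x mod 4 = 1 \<or> x mod 4 = 3" by presburger
    then have "[x = 1] (mod int 4) \<or> [x = - 1] (mod int 4)" by (simp add: cong_def)
    then show "pm_unit_square 4 x"
      using pm_unit_square_cong pm_unit_square_1 pm_unit_square_uminus by metis
  next
    assume "pm_unit_square 4 x"
    then have "coprime x (2 * 2)" using pm_unit_square_imp_coprime by fastforce
    then have "coprime x 2" by (simp only: coprime_mult_right_iff)
    then show "odd x" by simp
  qed
  then have ev: "quc_eigenvalue 4 j = 2 * (of_bool (4 dvd j) - of_bool (4 dvd j + 2))" for j
    using quc_eigenvalue_odd_units[of 4 2 j] by simp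
  have "quc_eigenvalue 4 j = (if odd j then 0 else if 4 dvd j then 2 else - 2)" for j
  proof -
    have "odd j \<Longrightarrow> \<not> 4 dvd j \<and> \<not> 4 dvd j + 2" "even j \<Longrightarrow> (4 dvd j + 2) = (\<not> 4 dvd j)"
      by presburger+
    then show ?thesis unfolding ev by auto
  qed
  moreover have "exp (- \<i> * of_real (pi / 2) * 2) = - 1" "exp (- \<i> * of_real (pi / 2) * - 2) = - 1"
    using exp_minus_ii_times[of "pi / 2" 2] exp_minus_ii_times[of "pi / 2" "- 2"]
    by (simp_all add: cis.code)
  ultimately have "parity_phase 4 (pi / 2) 0 (- 1)"
    unfolding parity_phase_def by simp
  then show ?thesis
    by (intro admits_fractional_revival_qucI) auto
qed

theorem theorem7p3:
  fixes n :: nat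
  assumes "n > 0"
  shows "admits_fractional_revival (quadratic_unitary_Cayley_graph n) \<longleftrightarrow>
    (\<exists>p::nat. prime p \<and> [p = 3] (mod 4) \<and> n \<in> {2, 4, 2 * p})"
proof
  assume adm: "admits_fractional_revival (quadratic_unitary_Cayley_graph n)"
  \<comment> \<open>Serves as the witness \<open>p\<close> when \<open>n\<close> is 2 or 4, where
    any prime of this class will do.\<close>
  have three: "prime (3::nat)" "[3 = 3] (mod (4::nat))" by simp_all
  have "n \<noteq> 1"
    using adm unfolding admits_fractional_revival_def fractional_revival_def
    by (auto simp: quadratic_unitary_Cayley_graph_def)
  then have "n \<ge> 2" using assms by simp
  then obtain t \<alpha> \<beta> where "even n" "t > 0" "\<beta> \<noteq> 0" and ph: "parity_phase n t \<alpha> \<beta>"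
    using adm admits_fractional_revival_quc_iff by blast
  show "\<exists>p::nat. prime p \<and> [p = 3] (mod 4) \<and> n \<in> {2, 4, 2 * p}"
  proof (cases "n = 2")
    case True
    then show ?thesis using three by blast
  next
    case False
    then have "n > 2" using \<open>n \<ge> 2\<close> by simp
    obtain h where "n = 2 * h" using \<open>even n\<close> by blast
    then have "quc_eigenvalue n j \<in> \<rat>" for j
      using quc_eigenvalue_rational[OF \<open>n > 2\<close> _ \<open>t > 0\<close> ph] by blast
    then have all: "all_units_pm_square n"
      unfolding all_units_pm_square_def using pm_unit_square_if_coprime[OF assms] by blast
    have "\<not> p * p dvd n" if "prime p" "odd p" for p
    proof
      assume "p * p dvd n"
      then have "quc_eigenvalue n j = 0" if "\<not> int p dvd j" for j
        using quc_eigenvalue_eq_0[OF assms all] that by blast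
      \<comment> \<open>The indices 1 and 2 have different parity; vanishing eigenvalues at both
        give phase 1 for both parities and hence \<open>\<beta> = 0\<close>.\<close>
      moreover have "\<not> int p dvd 1" "\<not> int p dvd 2"
        using that primes_dvd_imp_eq[of p 2] int_dvd_int_iff[of p 1] int_dvd_int_iff[of p 2] by auto
      ultimately have "quc_eigenvalue n 1 = 0" "quc_eigenvalue n 2 = 0" by blast+
      then have "\<alpha> + - \<beta> = 1" "\<alpha> + \<beta> = 1"
        using ph[unfolded parity_phase_def, rule_format, of 1]
          ph[unfolded parity_phase_def, rule_format, of 2] by simp_all
      then have "\<alpha> + \<beta> - (\<alpha> + - \<beta>) = 0" by simp
      then show False using \<open>\<beta> \<noteq> 0\<close> by simp
    qed
    then have "n = 4 \<or> (\<exists>p. prime p \<and> p mod 4 = 3 \<and> n = 2 * p)"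
      by (intro all_units_pm_square_classification \<open>even n\<close> \<open>n > 2\<close> all)
    then show ?thesis
      using three by (elim disjE) (blast, auto simp: cong_def)
  qed
next
  assume "\<exists>p::nat. prime p \<and> [p = 3] (mod 4) \<and> n \<in> {2, 4, 2 * p}"
  then obtain p :: nat where "prime p" "p mod 4 = 3" "n \<in> {2, 4, 2 * p}"
    by (auto simp: cong_def)
  then show "admits_fractional_revival (quadratic_unitary_Cayley_graph n)"
    using admits_fractional_revival_quc_2 admits_fractional_revival_quc_4
      admits_fractional_revival_quc_2p by auto
qed

end
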